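(* Let $\{u_j\},\{\tilde u_j\},\{y_j\}\subset V_h$ and coefficients $\beta_j^1,\beta_j^2\in\mathbb{R}$ be generated by the Anderson accelerated Newton iteration with depth $m=2$ (defined in the context). For every step $k\ge 3$ such that $\beta_k^2\neq 0$ and $u_j\in B(0,R)$ for all $j\le k$, where $R<\nu M^{-1}$, the residuals satisfy $$\|\nabla y_{k+1}\|\le \mathcal{O}\big((\|\nabla y_k\|+\|\nabla y_{k-1}\|)^{3/2}\big),$$ i.e. $\|\nabla y_{k+1}\|\le C\,(\|\nabla y_k\|+\|\nabla y_{k-1}\|)^{3/2}$, where the constant $C$ in the bound depends on the parameters $\nu,|\Omega|,R,f,\beta_k^1,\beta_k^2,\theta_k$, with $\theta_k=\|\nabla((1-\beta_k^1-\beta_k^2)y_k+\beta_k^1y_{k-1}+\beta_k^2y_{k-2})\|/\|\nabla y_k\|$.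
   Context: Setting. $\Omega\subset\mathbb{R}^d$ ($d=2,3$) is a simply connected domain that is a convex polytope or has smooth boundary; $(\cdot,\cdot)$ and $\|\cdot\|$ are the $L^2(\Omega)$ inner product and norm; $X=H_0^1(\Omega)^d$, $Q=L^2_0(\Omega)$; $\nu>0$; $f$ is a given forcing with dual norm $\|f\|_{-1}=\sup_{0\ne v\in X}(f,v)/\|\nabla v\|$. $X_h\subset X$, $Q_h\subset Q$ are finite-dimensional finite element spaces satisfying the discrete inf-sup condition, and $V_h=\{v\in X_h: (\nabla\cdot v,q)=0\ \forall q\in Q_h\}$. The trilinear form is $b(u,v,w)=\frac12\big((u\cdot\nabla v,w)-(u\cdot\nabla w,v)\big)$; it satisfies $b(u,v,v)=0$ and $b(u,v,w)\le M\|\nabla u\|\|\nabla v\|\|\nabla w\|$ for all $u,v,w\in X$, with a constant $M>0$ depending only on $|\Omega|$. The small data condition $\nu^{-2}M\|f\|_{-1}<1$ is assumed throughout. For $R<\nu M^{-1}$ let $B(0,R)=\{v\in V_h:\|\nabla v\|\le R\}$. For $u\in B(0,R)$, $G(u)\in V_h$ denotes the unique solution of $$b(u,G(u),v)+b(G(u),u,v)-b(u,u,v)+\nu(\nabla G(u),\nabla v)=(f,v)\quad\forall v\in V_h$$ (the Newton solution operator for the stationary Navier-Stokes equations). Anderson accelerated Newton iteration with depth $m=2$. Step 0: choose $u_0\in B(0,R)$. Step 1: $\tilde u_1=G(u_0)$, $y_1=\tilde u_1-u_0$, $u_1=\tilde u_1$. Step 2: $\tilde u_2=G(u_1)$, $y_2=\tilde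 u_2-u_1$; find $\alpha_2\in\mathbb{R}$ minimizing $\|\nabla((1-\alpha_2)y_2+\alpha_2y_1)\|$; $u_2=(1-\alpha_2)\tilde u_2+\alpha_2\tilde u_1$. Step $k$, $k=3,4,\dots$: (a) $\tilde u_k=G(u_{k-1})$, $y_k=\tilde u_k-u_{k-1}$; (b) find $\beta_k^1,\beta_k^2\in\mathbb{R}$ minimizing $\|\nabla((1-\beta_k^1-\beta_k^2)y_k+\beta_k^1y_{k-1}+\beta_k^2y_{k-2})\|$; (c) $u_k=(1-\beta_k^1-\beta_k^2)\tilde u_k+\beta_k^1\tilde u_{k-1}+\beta_k^2\tilde u_{k-2}$. *)

theory Defs
  imports "HOL-Analysis.Analysis"
begin

section \<open>Smooth functions and domains\<close>

primrec iter_deriv ::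
  "'a::real_normed_vector list \<Rightarrow> ('a \<Rightarrow> 'b::real_normed_vector) \<Rightarrow> 'a \<Rightarrow> 'b" where
  "iter_deriv [] f = f"
| "iter_deriv (e # es) f = (\<lambda>x. frechet_derivative (iter_deriv es f) (at x) e)"

text \<open>On an open set this is C-infinity: every iterated directional derivative is again
  differentiable, hence continuous.\<close>

definition smooth_on ::
  "'a::real_normed_vector set \<Rightarrow> ('a \<Rightarrow> 'b::real_normed_vector) \<Rightarrow> bool" where
  "smooth_on S f \<longleftrightarrow> (\<forall>es. \<forall>x\<in>S. iter_deriv es f differentiable (at x))"

definition test_function ::
  "'a::real_normed_vector set \<Rightarrow> ('a \<Rightarrow> 'b::real_normed_vector) \<Rightarrow> bool" where
  "test_function \<Omega> \<phi> \<longleftrightarrow> smooth_on UNIV \<phi> \<and>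
     compact (closure {x. \<phi> x \<noteq> 0}) \<and> closure {x. \<phi> x \<noteq> 0} \<subseteq> \<Omega>"

text \<open>Near each boundary point the domain is the strict sublevel set of a smooth function
  with nowhere vanishing gradient.\<close>

definition smooth_boundary :: "'a::real_normed_vector set \<Rightarrow> bool" where
  "smooth_boundary \<Omega> \<longleftrightarrow> (\<forall>p\<in>frontier \<Omega>. \<exists>U (\<rho>::'a \<Rightarrow> real). open U \<and> p \<in> U \<and> smooth_on U \<rho> \<and>
     (\<forall>x\<in>U. frechet_derivative \<rho> (at x) \<noteq> (\<lambda>_. 0)) \<and> \<Omega> \<inter> U = {x\<in>U. \<rho> x < 0})"

definition flow_domain :: "'a::euclidean_space set \<Rightarrow> bool" where
  "flow_domain \<Omega> \<longleftrightarrow> open \<Omega> \<and> connected \<Omega> \<and> \<Omega> \<noteq> {} \<and> bounded \<Omega> \<and> simply_connected \<Omega> \<and>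
     ((\<exists>P. polytope P \<and> \<Omega> = interior P) \<or> smooth_boundary \<Omega>)"


section \<open>Function spaces\<close>

text \<open>Elements of L2 and H1 are represented by functions; two functions that agree almost
  everywhere on the domain represent the same element.\<close>

definition square_integrable_on ::
  "('a::euclidean_space \<Rightarrow> 'b::euclidean_space) \<Rightarrow> 'a set \<Rightarrow> bool" (infix "square'_integrable'_on" 50) where
  "f square_integrable_on \<Omega> \<longleftrightarrow> f \<in> borel_measurable (lebesgue_on \<Omega>) \<and>
     integrable (lebesgue_on \<Omega>) (\<lambda>x. (norm (f x))\<^sup>2)"

definition l2_inner ::
  "'a::euclidean_space set \<Rightarrow> ('a \<Rightarrow> 'b::euclidean_space) \<Rightarrow> ('a \<Rightarrow> 'b) \<Rightarrow> real" where
  "l2_inner \<Omega> f g = (LINT x|lebesgue_on \<Omega>. f x \<bullet> g x)"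

definition l2_norm :: "'a::euclidean_space set \<Rightarrow> ('a \<Rightarrow> 'b::euclidean_space) \<Rightarrow> real" where
  "l2_norm \<Omega> f = sqrt (l2_inner \<Omega> f f)"

definition L20 :: "'a::euclidean_space set \<Rightarrow> ('a \<Rightarrow> real) set" where
  "L20 \<Omega> = {q. q square_integrable_on \<Omega> \<and> (LINT x|lebesgue_on \<Omega>. q x) = 0}"

type_synonym 'n vfield = "real^'n \<Rightarrow> real^'n"

text \<open>H10 is the closure of the test fields in the H1 norm: \<open>g\<close> is the weak gradient of \<open>v\<close>, with
  \<open>g x $ i $ j\<close> the \<open>j\<close>-th partial derivative of the \<open>i\<close>-th component. The norm on
  \<open>real^'n^'n\<close> is the Frobenius norm.\<close>

definition H10_gradient ::
  "(real^'n::finite) set \<Rightarrow> 'n vfield \<Rightarrow> (real^'n \<Rightarrow> real^'n^'n) \<Rightarrow> bool" where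
  "H10_gradient \<Omega> v g \<longleftrightarrow> v square_integrable_on \<Omega> \<and> g square_integrable_on \<Omega> \<and>
     (\<exists>\<phi>::nat \<Rightarrow> 'n vfield. (\<forall>n. test_function \<Omega> (\<phi> n)) \<and>
        (\<lambda>n. l2_norm \<Omega> (\<lambda>x. \<phi> n x - v x)) \<longlonglongrightarrow> 0 \<and>
        (\<lambda>n. l2_norm \<Omega> (\<lambda>x. matrix (frechet_derivative (\<phi> n) (at x)) - g x)) \<longlonglongrightarrow> 0)"

definition H10 :: "(real^'n::finite) set \<Rightarrow> 'n vfield set" where
  "H10 \<Omega> = {v. \<exists>g. H10_gradient \<Omega> v g}"

definition grad :: "(real^'n::finite) set \<Rightarrow> 'n vfield \<Rightarrow> real^'n \<Rightarrow> real^'n^'n" where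
  "grad \<Omega> v = (SOME g. H10_gradient \<Omega> v g)"

definition divergence :: "(real^'n::finite) set \<Rightarrow> 'n vfield \<Rightarrow> real^'n \<Rightarrow> real" where
  "divergence \<Omega> v = (\<lambda>x. trace (grad \<Omega> v x))"

definition grad_norm :: "(real^'n::finite) set \<Rightarrow> 'n vfield \<Rightarrow> real" where
  "grad_norm \<Omega> v = l2_norm \<Omega> (grad \<Omega> v)"


section \<open>Forcing and trilinear form\<close>

text \<open>A forcing is given by its action \<open>v \<mapsto> (f, v)\<close>, a bounded linear functional on \<open>H10 \<Omega>\<close>.\<close>

definition forcing :: "(real^'n::finite) set \<Rightarrow> ('n vfield \<Rightarrow> real) \<Rightarrow> bool" where
  "forcing \<Omega> f \<longleftrightarrow>
     (\<forall>v\<in>H10 \<Omega>. \<forall>w\<in>H10 \<Omega>. \<forall>a b. f (\<lambda>x. a *\<^sub>R v x + b *\<^sub>R w x) = a * f v + b * f w) \<and>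
     (\<exists>K. \<forall>v\<in>H10 \<Omega>. \<bar>f v\<bar> \<le> K * grad_norm \<Omega> v)"

definition dual_norm :: "(real^'n::finite) set \<Rightarrow> ('n vfield \<Rightarrow> real) \<Rightarrow> real" where
  "dual_norm \<Omega> f = (SUP v\<in>{v\<in>H10 \<Omega>. l2_norm \<Omega> v \<noteq> 0}. f v / grad_norm \<Omega> v)"

definition convection :: "(real^'n::finite) set \<Rightarrow> 'n vfield \<Rightarrow> 'n vfield \<Rightarrow> 'n vfield" where
  "convection \<Omega> u v = (\<lambda>x. grad \<Omega> v x *v u x)"

definition trilinear ::
  "(real^'n::finite) set \<Rightarrow> 'n vfield \<Rightarrow> 'n vfield \<Rightarrow> 'n vfield \<Rightarrow> real" where
  "trilinear \<Omega> u v w =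
     (l2_inner \<Omega> (convection \<Omega> u v) w - l2_inner \<Omega> (convection \<Omega> u w) v) / 2"

text \<open>The estimate for the trilinear form includes the convergence of its integrals on
  \<open>H10 \<Omega>\<close>; this must be said explicitly because a divergent Bochner integral has value 0.\<close>

definition trilinear_bound :: "(real^'n::finite) set \<Rightarrow> real \<Rightarrow> bool" where
  "trilinear_bound \<Omega> M \<longleftrightarrow> M > 0 \<and> (\<forall>u\<in>H10 \<Omega>. \<forall>v\<in>H10 \<Omega>. \<forall>w\<in>H10 \<Omega>.
     integrable (lebesgue_on \<Omega>) (\<lambda>x. convection \<Omega> u v x \<bullet> w x) \<and>
     trilinear \<Omega> u v w \<le> M * grad_norm \<Omega> u * grad_norm \<Omega> v * grad_norm \<Omega> w)"


section \<open>Discrete spaces\<close>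

definition finite_dim_subspace ::
  "('a \<Rightarrow> 'b::real_vector) set \<Rightarrow> ('a \<Rightarrow> 'b) set \<Rightarrow> bool" where
  "finite_dim_subspace S X \<longleftrightarrow>
     (\<exists>B. finite B \<and> B \<subseteq> X \<and> S = range (\<lambda>c x. \<Sum>b\<in>B. c b *\<^sub>R b x))"

definition discrete_inf_sup ::
  "(real^'n::finite) set \<Rightarrow> 'n vfield set \<Rightarrow> (real^'n \<Rightarrow> real) set \<Rightarrow> bool" where
  "discrete_inf_sup \<Omega> Xh Qh \<longleftrightarrow> (\<exists>\<gamma>>0. \<forall>q\<in>{q\<in>Qh. l2_norm \<Omega> q \<noteq> 0}.
     ereal \<gamma> \<le> (SUP v\<in>{v\<in>Xh. l2_norm \<Omega> v \<noteq> 0}.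
        ereal (l2_inner \<Omega> (divergence \<Omega> v) q / (grad_norm \<Omega> v * l2_norm \<Omega> q))))"

definition stable_pair ::
  "(real^'n::finite) set \<Rightarrow> 'n vfield set \<Rightarrow> (real^'n \<Rightarrow> real) set \<Rightarrow> bool" where
  "stable_pair \<Omega> Xh Qh \<longleftrightarrow> finite_dim_subspace Xh (H10 \<Omega>) \<and>
     finite_dim_subspace Qh (L20 \<Omega>) \<and> discrete_inf_sup \<Omega> Xh Qh"

definition discretely_div_free ::
  "(real^'n::finite) set \<Rightarrow> 'n vfield set \<Rightarrow> (real^'n \<Rightarrow> real) set \<Rightarrow> 'n vfield set" where
  "discretely_div_free \<Omega> Xh Qh = {v\<in>Xh. \<forall>q\<in>Qh. l2_inner \<Omega> (divergence \<Omega> v) q = 0}"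

definition grad_ball :: "(real^'n::finite) set \<Rightarrow> 'n vfield set \<Rightarrow> real \<Rightarrow> 'n vfield set" where
  "grad_ball \<Omega> Vh R = {v\<in>Vh. grad_norm \<Omega> v \<le> R}"


section \<open>Newton operator and Anderson acceleration\<close>

text \<open>The graph of the solution operator. It is a relation because the solution is unique only
  as an element of H1, that is, up to equality almost everywhere.\<close>

definition newton_solution ::
  "(real^'n::finite) set \<Rightarrow> real \<Rightarrow> ('n vfield \<Rightarrow> real) \<Rightarrow> 'n vfield set \<Rightarrow>
     'n vfield \<Rightarrow> 'n vfield \<Rightarrow> bool" where
  "newton_solution \<Omega> \<nu> f Vh u g \<longleftrightarrow> g \<in> Vh \<and> (\<forall>v\<in>Vh.
     trilinear \<Omega> u g v + trilinear \<Omega> g u v - trilinear \<Omega> u u v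
       + \<nu> * l2_inner \<Omega> (grad \<Omega> g) (grad \<Omega> v) = f v)"

definition combine2 :: "real \<Rightarrow> 'n::finite vfield \<Rightarrow> 'n vfield \<Rightarrow> 'n vfield" where
  "combine2 a v w = (\<lambda>x. (1 - a) *\<^sub>R v x + a *\<^sub>R w x)"

definition combine3 ::
  "real \<Rightarrow> real \<Rightarrow> 'n::finite vfield \<Rightarrow> 'n vfield \<Rightarrow> 'n vfield \<Rightarrow> 'n vfield" where
  "combine3 a b v w z = (\<lambda>x. (1 - a - b) *\<^sub>R v x + a *\<^sub>R w x + b *\<^sub>R z x)"

text \<open>The sequences are a run of the first \<open>N\<close> steps of the depth 2 method; values with larger
  indices are unconstrained, so that runs which leave the ball later are covered.\<close>

definition anderson_newton2 ::
  "(real^'n::finite) set \<Rightarrow> real \<Rightarrow> ('n vfield \<Rightarrow> real) \<Rightarrow> 'n vfield set \<Rightarrow> real \<Rightarrow> nat \<Rightarrow>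
     (nat \<Rightarrow> 'n vfield) \<Rightarrow> (nat \<Rightarrow> 'n vfield) \<Rightarrow> (nat \<Rightarrow> 'n vfield) \<Rightarrow>
     real \<Rightarrow> (nat \<Rightarrow> real) \<Rightarrow> (nat \<Rightarrow> real) \<Rightarrow> bool" where
  "anderson_newton2 \<Omega> \<nu> f Vh R N u ut y \<alpha>\<^sub>2 \<beta>\<^sub>1 \<beta>\<^sub>2 \<longleftrightarrow>
     u 0 \<in> grad_ball \<Omega> Vh R \<and>
     (\<forall>j\<in>{1..N}. newton_solution \<Omega> \<nu> f Vh (u (j - 1)) (ut j) \<and>
        y j = (\<lambda>x. ut j x - u (j - 1) x)) \<and>
     (1 \<le> N \<longrightarrow> u 1 = ut 1) \<and>
     (2 \<le> N \<longrightarrow>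
        is_arg_min (\<lambda>a. grad_norm \<Omega> (combine2 a (y 2) (y 1))) (\<lambda>_. True) \<alpha>\<^sub>2 \<and>
        u 2 = combine2 \<alpha>\<^sub>2 (ut 2) (ut 1)) \<and>
     (\<forall>j\<in>{3..N}.
        is_arg_min (\<lambda>(a, b). grad_norm \<Omega> (combine3 a b (y j) (y (j - 1)) (y (j - 2))))
          (\<lambda>_. True) (\<beta>\<^sub>1 j, \<beta>\<^sub>2 j) \<and>
        u j = combine3 (\<beta>\<^sub>1 j) (\<beta>\<^sub>2 j) (ut j) (ut (j - 1)) (ut (j - 2)))"

definition anderson_gain ::
  "(real^'n::finite) set \<Rightarrow> (nat \<Rightarrow> 'n vfield) \<Rightarrow> (nat \<Rightarrow> real) \<Rightarrow> (nat \<Rightarrow> real) \<Rightarrow> nat \<Rightarrow> real" where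
  "anderson_gain \<Omega> y \<beta>\<^sub>1 \<beta>\<^sub>2 k =
     grad_norm \<Omega> (combine3 (\<beta>\<^sub>1 k) (\<beta>\<^sub>2 k) (y k) (y (k - 1)) (y (k - 2))) / grad_norm \<Omega> (y k)"

end

theory Submission
  imports Defs "HOL-Library.Function_Algebras"
begin

text \<open>On the ball \<open>\<parallel>\<nabla>u\<parallel> \<le> R\<close> with \<open>R < \<nu>/M\<close> the discrete Navier--Stokes operator is strongly monotone, so the
  distance between two iterates is bounded linearly by their Newton residuals, while Newton's method
  makes \<open>\<parallel>\<nabla>(G u - G w)\<parallel>\<close> quadratically small in the distance and the residual. Optimality of the
  coefficients together with \<open>\<beta>\<^sub>2 \<noteq> 0\<close> bounds the oldest residual by the two newest ones. Hence the next
  residual is even quadratic in their sum, and since residuals in the ball are bounded a priori by the small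
  data condition, half a power can be given away.

  The Newton relation determines functions only almost everywhere, and the gradient is a choice
  among weak gradients; linearity of the gradient rests on the uniqueness of weak gradients, proved by
  integrating by parts against polynomials.\<close>

section \<open>Residuals of the Newton operator in an abstract setting\<close>

text \<open>The three weights sum to one, so the new iterate u has the residual G u - u = sum of
  beta_i (G u - G u_i) over the older iterates u_i, and only differences of Newton images matter.
  Subtracting two Newton equations cancels every term that is linear in u - u_i; what survives is a
  product of two factors, each a distance or a residual. The distances come from reading the Newton
  equation as an equation for the residual y: the linearised operator applied to y equals the
  nonlinear residual. Continuity of the linearisation makes the nonlinear residual small when y is
  small, and monotonicity makes two points with small nonlinear residuals close. Since every iterate
  involved lies in the ball, this applies to each pair of them. The argument uses nothing but a
  semidefinite form and a bounded trilinear form, hence the abstract locales.\<close>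

locale semi_inner_product =
  fixes V :: "'a::real_vector set" and D :: "'a \<Rightarrow> 'a \<Rightarrow> real"
  assumes V: "subspace V"
    and D_lin: "\<And>r s u v w. u \<in> V \<Longrightarrow> v \<in> V \<Longrightarrow> w \<in> V \<Longrightarrow> D (r *\<^sub>R u + s *\<^sub>R v) w = r * D u w + s * D v w"
    and D_sym: "\<And>u v. D u v = D v u"
    and D_nonneg: "\<And>u. u \<in> V \<Longrightarrow> 0 \<le> D u u"
begin

definition N :: "'a \<Rightarrow> real" where "N v = sqrt (D v v)"

lemma V_add: "u \<in> V \<Longrightarrow> v \<in> V \<Longrightarrow> u + v \<in> V"
  and V_diff: "u \<in> V \<Longrightarrow> v \<in> V \<Longrightarrow> u - v \<in> V"
  and V_scale: "u \<in> V \<Longrightarrow> r *\<^sub>R u \<in> V"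
  using V by (auto simp: subspace_add subspace_diff subspace_scale)

lemma D_simps:
  assumes "u \<in> V" "v \<in> V" "w \<in> V"
  shows "D (u + v) w = D u w + D v w" "D (u - v) w = D u w - D v w" "D (r *\<^sub>R u) w = r * D u w"
    "D w (u + v) = D w u + D w v" "D w (u - v) = D w u - D w v" "D w (r *\<^sub>R u) = r * D w u"
  using D_lin[of u v w 1 1] D_lin[of u v w 1 "-1"] D_lin[of u u w r 0] assms
  by (simp_all add: D_sym[of w])

lemma N_nonneg: "v \<in> V \<Longrightarrow> 0 \<le> N v"
  by (simp add: N_def D_nonneg)

lemma N_square: "v \<in> V \<Longrightarrow> D v v = (N v)\<^sup>2"
  by (simp add: N_def D_nonneg)

lemma N_scale: "v \<in> V \<Longrightarrow> N (r *\<^sub>R v) = \<bar>r\<bar> * N v"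
  by (simp add: N_def D_simps V_scale real_sqrt_mult flip: mult.assoc power2_eq_square)

text \<open>\<open>D\<close> may vanish on nonzero vectors, for instance on functions that are zero
  almost everywhere. The usual division by \<open>D u u\<close> therefore needs a degenerate case
  beside it.\<close>

lemma D_le:
  assumes u: "u \<in> V" and v: "v \<in> V"
  shows "\<bar>D u v\<bar> \<le> N u * N v"
proof -
  have q: "0 \<le> D u u * t\<^sup>2 + 2 * D u v * t + D v v" for t
    using D_nonneg[of "t *\<^sub>R u + v"] u v
    by (simp add: D_simps V_add V_scale algebra_simps power2_eq_square D_sym[of v u])
  have "(D u v)\<^sup>2 \<le> D u u * D v v"
  proof (cases "D u u = 0")
    case True
    have "D u v = 0"
    proof (rule ccontr)
      assume "D u v \<noteq> 0"
      \<comment> \<open>At this t the expression in \<open>q\<close>, which is affine in t here,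
        equals -1.\<close>
      then show False
        using q[of "- (D v v + 1) / (2 * D u v)"] True by (simp add: field_simps)
    qed
    then show ?thesis using True by simp
  next
    case False
    then have p: "D u u > 0" using D_nonneg[OF u] by simp
    have "0 \<le> D v v - (D u v)\<^sup>2 / D u u"
      \<comment> \<open>The chosen t minimises the quadratic.\<close>
      using q[of "- D u v / D u u"] p by (simp add: field_simps power2_eq_square)
    then show ?thesis using p by (simp add: field_simps)
  qed
  also have "\<dots> = (N u * N v)\<^sup>2" using u v by (simp add: N_square power_mult_distrib)
  finally show ?thesis using N_nonneg u v by (metis abs_le_square_iff abs_of_nonneg mult_nonneg_nonneg)
qed

lemma N_add:
  assumes "u \<in> V" "v \<in> V"
  shows "N (u + v) \<le> N u + N v"
proof (rule power2_le_imp_le)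
  show "(N (u + v))\<^sup>2 \<le> (N u + N v)\<^sup>2"
    using D_le[OF assms] assms
    by (simp add: N_square[symmetric] V_add D_simps power2_sum D_sym[of v u])
qed (use assms N_nonneg in auto)

lemma N_uminus: "v \<in> V \<Longrightarrow> N (- v) = N v"
  using N_scale[of v "-1"] by simp

lemma N_diff: "u \<in> V \<Longrightarrow> v \<in> V \<Longrightarrow> N (u - v) \<le> N u + N v"
  using N_add[of u "-v"] by (simp add: N_uminus V subspace_neg)

end

text \<open>\<open>f_le\<close> is the small data condition with the dual norm eliminated, so f
  enters the later constants only as \<open>\<nu>\<^sup>2 / M\<close>. Linearity of \<open>b\<close>
  is asked on \<open>V\<close> alone, where the integrals behind it converge.\<close>

locale navier_stokes_form = semi_inner_product V D
  for V :: "'a::real_vector set" and D +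
  fixes b :: "'a \<Rightarrow> 'a \<Rightarrow> 'a \<Rightarrow> real"
    and M \<nu> R :: real and f :: "'a \<Rightarrow> real"
  assumes b1: "\<And>r s u v w z. u \<in> V \<Longrightarrow> v \<in> V \<Longrightarrow> w \<in> V \<Longrightarrow> z \<in> V \<Longrightarrow>
      b (r *\<^sub>R u + s *\<^sub>R v) w z = r * b u w z + s * b v w z"
    and b2: "\<And>r s u v w z. u \<in> V \<Longrightarrow> v \<in> V \<Longrightarrow> w \<in> V \<Longrightarrow> z \<in> V \<Longrightarrow>
      b w (r *\<^sub>R u + s *\<^sub>R v) z = r * b w u z + s * b w v z"
    and b3: "\<And>r s u v w z. u \<in> V \<Longrightarrow> v \<in> V \<Longrightarrow> w \<in> V \<Longrightarrow> z \<in> V \<Longrightarrow>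
      b w z (r *\<^sub>R u + s *\<^sub>R v) = r * b w z u + s * b w z v"
    and b_skew: "\<And>u v. b u v v = 0"
    and b_le: "\<And>u v w. u \<in> V \<Longrightarrow> v \<in> V \<Longrightarrow> w \<in> V \<Longrightarrow>
      b u v w \<le> M * sqrt (D u u) * sqrt (D v v) * sqrt (D w w)"
    and M: "M > 0" and \<nu>: "\<nu> > 0" and R: "R < \<nu> / M"
    and f_le: "\<And>v. v \<in> V \<Longrightarrow> f v \<le> \<nu>\<^sup>2 / M * sqrt (D v v)"
begin

definition newton :: "'a \<Rightarrow> 'a \<Rightarrow> bool" where
  "newton u g \<longleftrightarrow> g \<in> V \<and> (\<forall>v\<in>V. b u g v + b g u v - b u u v + \<nu> * D g v = f v)"

text \<open>The coercivity constant of the linearised operator at a point u of the ball: testing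
  with v leaves \<open>b v u v + \<nu> * D v v\<close>, whose first term is at least -M R (N
  v)^2.\<close>

abbreviation "\<kappa> \<equiv> \<nu> - M * R"

lemma kappa_pos: "\<kappa> > 0"
  using R M by (simp add: field_simps)

lemma b_simps:
  assumes "u \<in> V" "v \<in> V" "w \<in> V" "z \<in> V"
  shows "b (u + v) w z = b u w z + b v w z" "b (u - v) w z = b u w z - b v w z"
    "b w (u + v) z = b w u z + b w v z" "b w (u - v) z = b w u z - b w v z"
    "b w z (u + v) = b w z u + b w z v" "b w z (u - v) = b w z u - b w z v"
  using b1[of u v w z 1 1] b1[of u v w z 1 "-1"] b2[of u v w z 1 1] b2[of u v w z 1 "-1"]
    b3[of u v w z 1 1] b3[of u v w z 1 "-1"] assms
  by simp_all

text \<open>\<open>b_le\<close> is one-sided; replacing u by its negative gives the other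
  side.\<close>

lemma b_abs_le:
  assumes "u \<in> V" "v \<in> V" "w \<in> V"
  shows "\<bar>b u v w\<bar> \<le> M * N u * N v * N w"
  using b_le[of u v w] b_le[of "(-1) *\<^sub>R u" v w] assms b1[of u u v w "-1" 0] V_scale[of u "-1"]
    N_uminus[of u]
  by (simp add: N_def)

lemma newton_in: "newton u g \<Longrightarrow> g \<in> V"
  by (simp add: newton_def)

text \<open>Newton's method in correction form: on the left the derivative of the Navier-Stokes
  operator at u, applied to the correction g - u; on the right the nonlinear residual at u.\<close>

lemma newton_residual:
  assumes "newton u g" "u \<in> V" "v \<in> V"
  shows "b u (g - u) v + b (g - u) u v + \<nu> * D (g - u) v = f v - b u u v - \<nu> * D u v"
proof -
  have "g \<in> V" using assms(1) by (simp add: newton_def)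
  moreover have "b u g v + b g u v - b u u v + \<nu> * D g v = f v"
    using assms by (simp add: newton_def)
  ultimately show ?thesis
    using assms(2,3) by (simp add: b_simps D_simps algebra_simps)
qed

lemma b_radius:
  assumes "u \<in> V" "v \<in> V" "w \<in> V" "N u \<le> R"
  shows "\<bar>b u v w\<bar> \<le> M * R * N v * N w" "\<bar>b v u w\<bar> \<le> M * R * N v * N w"
proof -
  have "M * N u * N v * N w \<le> M * R * N v * N w"
    using assms M N_nonneg by (intro mult_right_mono mult_left_mono) auto
  then show "\<bar>b u v w\<bar> \<le> M * R * N v * N w" "\<bar>b v u w\<bar> \<le> M * R * N v * N w"
    using b_abs_le[OF assms(1,2,3)] b_abs_le[OF assms(2,1,3)] by (auto simp: mult_ac)
qed

text \<open>The factor \<open>\<nu> + 2 * M * R\<close> bounds the linearised operator at a point of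
  the ball: one diffusion term and two convection terms.\<close>

lemma residual_le:
  assumes "newton u g" "u \<in> V" "v \<in> V" "N u \<le> R"
  shows "\<bar>f v - b u u v - \<nu> * D u v\<bar> \<le> (\<nu> + 2 * M * R) * N (g - u) * N v"
proof -
  have y: "g - u \<in> V" using assms newton_in V_diff by blast
  have "\<bar>\<nu> * D (g - u) v\<bar> \<le> \<nu> * (N (g - u) * N v)"
    using D_le[OF y assms(3)] \<nu> by (simp add: abs_mult)
  then show ?thesis
    using newton_residual[OF assms(1,2,3)] b_radius[OF assms(2) y assms(3,4)]
    by (simp add: algebra_simps)
qed

text \<open>Strong monotonicity: for e = u - w, the difference of the convection terms tested with e
  is b(e,w,e), because b(u,e,e) vanishes. On the ball viscosity dominates it, so the difference of
  the nonlinear residuals controls e.\<close>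

lemma distance_le_residuals:
  assumes u: "newton u g" "u \<in> V" "N u \<le> R" and w: "newton w h" "w \<in> V" "N w \<le> R"
  shows "\<kappa> * N (u - w) \<le> (\<nu> + 2 * M * R) * (N (g - u) + N (h - w))"
proof -
  let ?e = "u - w"
  have e: "?e \<in> V" using u w V_diff by blast
  have "(f ?e - b w w ?e - \<nu> * D w ?e) - (f ?e - b u u ?e - \<nu> * D u ?e)
      = b ?e w ?e + \<nu> * (N ?e)\<^sup>2"
    using u(2) w(2) e b_skew[of u ?e]
    by (simp add: b_simps D_simps V_diff N_square[symmetric, OF e] algebra_simps)
  moreover have "b ?e w ?e \<ge> - (M * R * N ?e * N ?e)"
    using b_radius(2)[OF w(2) e e w(3)] by simp
  ultimately have "\<kappa> * N ?e * N ?e \<le> (\<nu> + 2 * M * R) * (N (g - u) + N (h - w)) * N ?e"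
    using residual_le[OF u(1,2) e u(3)] residual_le[OF w(1,2) e w(3)]
    by (simp add: algebra_simps power2_eq_square abs_le_iff)
  \<comment> \<open>The sign settles the case \<open>N ?e = 0\<close>, where no factor can be
    cancelled.\<close>
  moreover have "0 \<le> (\<nu> + 2 * M * R) * (N (g - u) + N (h - w))"
  proof -
    have "0 \<le> R" using N_nonneg[OF u(2)] u(3) by linarith
    then have "0 \<le> \<nu> + 2 * M * R" using \<nu> M by simp
    then show ?thesis using N_nonneg V_diff newton_in u w by simp
  qed
  ultimately show ?thesis
    using N_nonneg[OF e] by (cases "N ?e = 0") auto
qed

text \<open>Subtract the two Newton equations, test with p = g - h and write h = w + (h - w), u = w
  + e. The first-order terms b(e,w,p) and b(w,e,p) cancel, and the right side keeps only b(e,e,p)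
  and the two products of e with h - w. This is where the quadratic behaviour originates.\<close>

lemma newton_difference:
  assumes u: "newton u g" "u \<in> V" "N u \<le> R" and w: "newton w h" "w \<in> V"
  shows "\<kappa> * N (g - h) \<le> 2 * M * N (u - w) * N (h - w) + M * (N (u - w))\<^sup>2"
proof -
  let ?e = "u - w" and ?p = "g - h" and ?z = "h - w"
  have g: "g \<in> V" and h: "h \<in> V" using u w newton_in by auto
  have e: "?e \<in> V" and p: "?p \<in> V" and z: "?z \<in> V" using u w g h V_diff by blast+
  have "b u g ?p + b g u ?p - b u u ?p + \<nu> * D g ?p = f ?p"
    and "b w h ?p + b h w ?p - b w w ?p + \<nu> * D h ?p = f ?p"
    using u w p by (auto simp: newton_def)
  then have "b ?p u ?p + \<nu> * (N ?p)\<^sup>2 = b ?e ?e ?p - b ?e ?z ?p - b ?z ?e ?p"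
    using u(2) w(2) g h p b_skew[of u ?p]
    by (simp add: b_simps D_simps V_diff N_square[symmetric, OF p] algebra_simps)
  moreover have "b ?p u ?p \<ge> - (M * R * N ?p * N ?p)"
    using b_radius(2)[OF u(2) p p u(3)] by simp
  ultimately have "\<kappa> * N ?p * N ?p \<le> (2 * M * N ?e * N ?z + M * (N ?e)\<^sup>2) * N ?p"
    using b_abs_le[OF e e p] b_abs_le[OF e z p] b_abs_le[OF z e p]
    by (simp add: algebra_simps power2_eq_square abs_le_iff)
  moreover have "0 \<le> 2 * M * N ?e * N ?z + M * (N ?e)\<^sup>2"
    using M N_nonneg e z by simp
  ultimately show ?thesis
    using N_nonneg[OF p] by (cases "N ?p = 0") auto
qed

text \<open>Testing the correction equation with the correction itself gives an a priori bound; its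
  three summands stem from forcing, convection and diffusion. It serves to trade half a power of the
  residuals for a constant.\<close>

lemma residual_bound:
  assumes u: "newton u g" "u \<in> V" "N u \<le> R"
  shows "\<kappa> * N (g - u) \<le> \<nu>\<^sup>2 / M + M * R\<^sup>2 + \<nu> * R"
proof -
  let ?y = "g - u"
  have y: "?y \<in> V" using u newton_in V_diff by blast
  have R0: "0 \<le> R" using N_nonneg[OF u(2)] u(3) by linarith
  have "b ?y u ?y + \<nu> * (N ?y)\<^sup>2 = f ?y - b u u ?y - \<nu> * D u ?y"
    using newton_residual[OF u(1,2) y] b_skew[of u ?y] N_square[OF y] by simp
  moreover have "b ?y u ?y \<ge> - (M * R * N ?y * N ?y)"
    using b_radius(2)[OF u(2) y y u(3)] by simp
  moreover have "- b u u ?y \<le> M * R * R * N ?y"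
  proof -
    have "M * R * N u * N ?y \<le> M * R * R * N ?y"
      using u(3) M R0 N_nonneg[OF y] by (intro mult_right_mono mult_left_mono) auto
    then show ?thesis using b_radius(1)[OF u(2) u(2) y u(3)] by linarith
  qed
  moreover have "- (\<nu> * D u ?y) \<le> \<nu> * R * N ?y"
  proof -
    have "\<nu> * (- D u ?y) \<le> \<nu> * (N u * N ?y)"
      using D_le[OF u(2) y] \<nu> by (intro mult_left_mono) auto
    also have "\<dots> \<le> \<nu> * (R * N ?y)"
      using u(3) \<nu> N_nonneg[OF y] by (intro mult_left_mono mult_right_mono) auto
    finally show ?thesis by (simp add: mult.assoc)
  qed
  moreover have "f ?y \<le> \<nu>\<^sup>2 / M * N ?y" using f_le[OF y] by (simp add: N_def)
  ultimately have "\<kappa> * N ?y * N ?y \<le> (\<nu>\<^sup>2 / M + M * R\<^sup>2 + \<nu> * R) * N ?y"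
    by (simp add: algebra_simps power2_eq_square)
  moreover have "0 \<le> \<nu>\<^sup>2 / M + M * R\<^sup>2 + \<nu> * R"
    using M \<nu> R0 by simp
  ultimately show ?thesis
    using N_nonneg[OF y] by (cases "N ?y = 0") auto
qed

end

text \<open>With s the sum of the two newest residual norms: \<open>\<Gamma>\<close> is the total
  weight, \<open>A\<close> times s bounds all three older residuals, and \<open>E\<close> times s
  bounds the distance from the new iterate to each older one. The middle factor is the quadratic
  constant of \<open>newton_difference\<close>, and the square root pays for lowering the exponent
  from 2 to 3/2.\<close>

definition anderson_const :: "real \<Rightarrow> real \<Rightarrow> real \<Rightarrow> real \<Rightarrow> real \<Rightarrow> real" where
  "anderson_const M \<nu> R \<beta>\<^sub>1 \<beta>\<^sub>2 =
    (let \<kappa> = \<nu> - M * R; \<Gamma> = \<bar>1 - \<beta>\<^sub>1 - \<beta>\<^sub>2\<bar> + \<bar>\<beta>\<^sub>1\<bar> + \<bar>\<beta>\<^sub>2\<bar>;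
       A = 1 + (1 + \<bar>1 - \<beta>\<^sub>1 - \<beta>\<^sub>2\<bar> + \<bar>\<beta>\<^sub>1\<bar>) / \<bar>\<beta>\<^sub>2\<bar>;
       E = 1 + 2 * \<Gamma> * ((\<nu> + 2 * M * R) / \<kappa>) * A
     in \<Gamma> * ((2 * M * E * A + M * E\<^sup>2) / \<kappa>) * sqrt (2 * ((\<nu>\<^sup>2 / M + M * R\<^sup>2 + \<nu> * R) / \<kappa>)))"

context navier_stokes_form
begin

text \<open>Indices run from newest to oldest: \<open>u0\<close>, \<open>u1\<close>,
  \<open>u2\<close> stand for the iterates of steps k-1, k-2, k-3, the \<open>g\<close> with the
  same index is the Newton image, and \<open>u\<close> is the iterate of step k. Hence g - u is the
  residual of step k+1. \<open>opt\<close> compares the minimiser with the trivial choice of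
  weights.\<close>

lemma anderson_step:
  assumes u0: "newton u0 g0" "u0 \<in> V" "N u0 \<le> R" and u1: "newton u1 g1" "u1 \<in> V" "N u1 \<le> R"
    and u2: "newton u2 g2" "u2 \<in> V" "N u2 \<le> R" and u: "newton u g" "u \<in> V" "N u \<le> R"
    and u_eq: "u = (1 - \<beta>\<^sub>1 - \<beta>\<^sub>2) *\<^sub>R g0 + \<beta>\<^sub>1 *\<^sub>R g1 + \<beta>\<^sub>2 *\<^sub>R g2"
    and opt: "N ((1 - \<beta>\<^sub>1 - \<beta>\<^sub>2) *\<^sub>R (g0 - u0) + \<beta>\<^sub>1 *\<^sub>R (g1 - u1) + \<beta>\<^sub>2 *\<^sub>R (g2 - u2)) \<le> N (g0 - u0)"
    and \<beta>\<^sub>2: "\<beta>\<^sub>2 \<noteq> 0"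
  shows "N (g - u) \<le> anderson_const M \<nu> R \<beta>\<^sub>1 \<beta>\<^sub>2 * (N (g0 - u0) + N (g1 - u1)) powr (3 / 2)"
proof -
  define \<beta>\<^sub>0 where "\<beta>\<^sub>0 = 1 - \<beta>\<^sub>1 - \<beta>\<^sub>2"
  define y0 y1 y2 where "y0 = g0 - u0" and "y1 = g1 - u1" and "y2 = g2 - u2"
  define s where "s = N y0 + N y1"
  define yb where "yb = \<beta>\<^sub>0 *\<^sub>R y0 + \<beta>\<^sub>1 *\<^sub>R y1 + \<beta>\<^sub>2 *\<^sub>R y2"
  define L where "L = (\<nu> + 2 * M * R) / \<kappa>"
  define \<Gamma> where "\<Gamma> = \<bar>\<beta>\<^sub>0\<bar> + \<bar>\<beta>\<^sub>1\<bar> + \<bar>\<beta>\<^sub>2\<bar>"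
  define A where "A = 1 + (1 + \<bar>\<beta>\<^sub>0\<bar> + \<bar>\<beta>\<^sub>1\<bar>) / \<bar>\<beta>\<^sub>2\<bar>"
  define E where "E = 1 + 2 * \<Gamma> * L * A"
  define K where "K = (2 * M * E * A + M * E\<^sup>2) / \<kappa>"
  define S where "S = (\<nu>\<^sup>2 / M + M * R\<^sup>2 + \<nu> * R) / \<kappa>"
  note newton_in[OF u0(1), simp] newton_in[OF u1(1), simp] newton_in[OF u2(1), simp]
    newton_in[OF u(1), simp] u0(2)[simp] u1(2)[simp] u2(2)[simp] u(2)[simp]
  have y_in[simp]: "y0 \<in> V" "y1 \<in> V" "y2 \<in> V"
    by (auto simp: y0_def y1_def y2_def V_diff)
  have R0: "0 \<le> R" using N_nonneg[OF u(2)] u(3) by linarith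
  have L0: "0 \<le> L" using R0 M \<nu> kappa_pos by (simp add: L_def)
  have \<Gamma>0: "0 \<le> \<Gamma>" by (simp add: \<Gamma>_def)
  have A1: "1 \<le> A" by (simp add: A_def)
  have E0: "0 \<le> E" using L0 \<Gamma>0 A1 by (simp add: E_def)
  have K0: "0 \<le> K" using M E0 A1 kappa_pos by (simp add: K_def)
  have s0: "0 \<le> s" by (simp add: s_def N_nonneg)
  have As: "s \<le> A * s" using A1 s0 by (simp add: mult_le_cancel_right1)
  have y0: "N y0 \<le> s" and y1: "N y1 \<le> s" by (simp_all add: s_def N_nonneg)
  have yb: "N yb \<le> s"
    using opt y0 by (simp add: yb_def \<beta>\<^sub>0_def y0_def y1_def y2_def)
  \<comment> \<open>the oldest residual is controlled by the two newest ones because its weight is nonzero\<close>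
  have y2: "N y2 \<le> A * s"
  proof -
    have "\<beta>\<^sub>2 *\<^sub>R y2 = yb - (\<beta>\<^sub>0 *\<^sub>R y0 + \<beta>\<^sub>1 *\<^sub>R y1)" by (simp add: yb_def)
    moreover have "yb \<in> V" by (simp add: yb_def V_add V_scale)
    ultimately have "\<bar>\<beta>\<^sub>2\<bar> * N y2 \<le> N yb + N (\<beta>\<^sub>0 *\<^sub>R y0 + \<beta>\<^sub>1 *\<^sub>R y1)"
      using N_diff[of yb "\<beta>\<^sub>0 *\<^sub>R y0 + \<beta>\<^sub>1 *\<^sub>R y1"] N_scale[of y2 \<beta>\<^sub>2] by (simp add: V_add V_scale)
    also have "\<dots> \<le> N yb + (\<bar>\<beta>\<^sub>0\<bar> * N y0 + \<bar>\<beta>\<^sub>1\<bar> * N y1)"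
      using N_add[of "\<beta>\<^sub>0 *\<^sub>R y0" "\<beta>\<^sub>1 *\<^sub>R y1"] by (simp add: V_scale N_scale)
    also have "\<dots> \<le> s + (\<bar>\<beta>\<^sub>0\<bar> * s + \<bar>\<beta>\<^sub>1\<bar> * s)"
      using yb y0 y1 by (intro add_mono mult_left_mono) auto
    finally have "N y2 \<le> (1 + \<bar>\<beta>\<^sub>0\<bar> + \<bar>\<beta>\<^sub>1\<bar>) / \<bar>\<beta>\<^sub>2\<bar> * s"
      using \<beta>\<^sub>2 by (simp add: field_simps)
    then show ?thesis using s0 by (simp add: A_def distrib_right)
  qed
  \<comment> \<open>Kept general in w so that one argument covers all three older iterates.\<close>
  have e: "N (u - w) \<le> E * s" and p: "N (g - h) \<le> K * s\<^sup>2"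
    if w: "newton w h" "w \<in> V" "N w \<le> R" and z: "N (h - w) \<le> A * s" for w h
  proof -
    have h[simp]: "h \<in> V" "w \<in> V" using w newton_in by auto
    have d: "N (v - w) \<le> 2 * L * A * s"
      if v: "newton v q" "v \<in> V" "N v \<le> R" "N (q - v) \<le> A * s" for v q
    proof -
      have "N (v - w) \<le> L * (N (q - v) + N (h - w))"
        using distance_le_residuals[OF v(1-3) w(1-3)] kappa_pos by (simp add: L_def field_simps)
      also have "\<dots> \<le> L * (A * s + A * s)"
        using L0 v(4) z by (intro mult_left_mono add_mono) auto
      finally show ?thesis by simp
    qed
    have d0: "N (u0 - w) \<le> 2 * L * A * s" and d1: "N (u1 - w) \<le> 2 * L * A * s"
      and d2: "N (u2 - w) \<le> 2 * L * A * s"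
      using d[OF u0] d[OF u1] d[OF u2] y0 y1 y2 As by (auto simp: y0_def y1_def y2_def)
    \<comment> \<open>Each image is iterate plus residual, and w may be split with the same weights
      because they sum to one.\<close>
    have uw: "u - w = yb + (\<beta>\<^sub>0 *\<^sub>R (u0 - w) + \<beta>\<^sub>1 *\<^sub>R (u1 - w) + \<beta>\<^sub>2 *\<^sub>R (u2 - w))"
    proof -
      have "w = (\<beta>\<^sub>0 + \<beta>\<^sub>1 + \<beta>\<^sub>2) *\<^sub>R w" by (simp add: \<beta>\<^sub>0_def)
      then have w: "w = \<beta>\<^sub>0 *\<^sub>R w + \<beta>\<^sub>1 *\<^sub>R w + \<beta>\<^sub>2 *\<^sub>R w" by (simp only: scaleR_add_left)
      show ?thesis
        by (subst w) (simp add: u_eq yb_def y0_def y1_def y2_def scaleR_diff_right flip: \<beta>\<^sub>0_def)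
    qed
    have "N (u - w) \<le> N yb + (N (\<beta>\<^sub>0 *\<^sub>R (u0 - w)) + N (\<beta>\<^sub>1 *\<^sub>R (u1 - w)) + N (\<beta>\<^sub>2 *\<^sub>R (u2 - w)))"
      unfolding uw
      by (intro order_trans[OF N_add] add_left_mono add_mono order_refl)
        (simp_all add: yb_def V_add V_scale V_diff)
    \<comment> \<open>The summand s is the optimised residual; the rest are distances between older
      iterates. This explains the form of \<open>E\<close>.\<close>
    also have "\<dots> \<le> s + (\<bar>\<beta>\<^sub>0\<bar> * (2 * L * A * s) + \<bar>\<beta>\<^sub>1\<bar> * (2 * L * A * s) + \<bar>\<beta>\<^sub>2\<bar> * (2 * L * A * s))"
      using yb d0 d1 d2 by (simp add: N_scale V_diff) (intro add_mono mult_left_mono; simp)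
    also have "\<dots> = E * s" by (simp add: E_def \<Gamma>_def algebra_simps)
    finally show e: "N (u - w) \<le> E * s" .
    have "\<kappa> * N (g - h) \<le> 2 * M * N (u - w) * N (h - w) + M * (N (u - w))\<^sup>2"
      using newton_difference[OF u w(1,2)] .
    also have "\<dots> \<le> 2 * M * (E * s) * (A * s) + M * (E * s)\<^sup>2"
      using e z M N_nonneg E0 s0
      by (intro add_mono mult_mono mult_left_mono power_mono) (auto simp: V_diff)
    also have "\<dots> = (2 * M * E * A + M * E\<^sup>2) * s\<^sup>2"
      by (simp add: algebra_simps power2_eq_square)
    finally show "N (g - h) \<le> K * s\<^sup>2"
      using kappa_pos by (simp add: K_def field_simps)
  qed
  \<comment> \<open>Again because the weights sum to one, g can be distributed over the three
    images.\<close>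
  have "g - u = \<beta>\<^sub>0 *\<^sub>R (g - g0) + \<beta>\<^sub>1 *\<^sub>R (g - g1) + \<beta>\<^sub>2 *\<^sub>R (g - g2)"
    by (simp add: u_eq \<beta>\<^sub>0_def algebra_simps)
  also have "N \<dots> \<le> N (\<beta>\<^sub>0 *\<^sub>R (g - g0)) + N (\<beta>\<^sub>1 *\<^sub>R (g - g1)) + N (\<beta>\<^sub>2 *\<^sub>R (g - g2))"
    by (intro order_trans[OF N_add] add_mono order_refl) (simp_all add: V_add V_scale V_diff)
  also have "\<dots> \<le> \<bar>\<beta>\<^sub>0\<bar> * (K * s\<^sup>2) + \<bar>\<beta>\<^sub>1\<bar> * (K * s\<^sup>2) + \<bar>\<beta>\<^sub>2\<bar> * (K * s\<^sup>2)"
    using p[OF u0] p[OF u1] p[OF u2] y0 y1 y2 As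
    by (simp add: N_scale V_diff y0_def y1_def y2_def) (intro add_mono mult_left_mono; simp)
  also have "\<dots> = \<Gamma> * K * s\<^sup>2"
    by (simp add: \<Gamma>_def algebra_simps)
  \<comment> \<open>Split s^2 as s^(1/2) s^(3/2) and bound the first factor by the a priori estimate
    s \<le> 2 S.\<close>
  also have "s\<^sup>2 \<le> sqrt (2 * S) * s powr (3 / 2)"
  proof -
    have "N y0 \<le> S" "N y1 \<le> S"
      using residual_bound[OF u0] residual_bound[OF u1] kappa_pos
      by (auto simp: S_def y0_def y1_def field_simps)
    then have "s \<le> 2 * S" by (simp add: s_def)
    then have "sqrt s * s powr (3 / 2) \<le> sqrt (2 * S) * s powr (3 / 2)"
      by (intro mult_right_mono) auto
    moreover have "sqrt s * s powr (3 / 2) = s\<^sup>2"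
      using s0 by (cases "s = 0") (simp_all add: powr_half_sqrt[symmetric] flip: powr_add powr_numeral)
    ultimately show ?thesis by simp
  qed
  finally have "N (g - u) \<le> \<Gamma> * K * (sqrt (2 * S) * s powr (3 / 2))"
    using \<Gamma>0 K0 by (meson mult_left_mono mult_nonneg_nonneg order_trans)
  also have "\<dots> = anderson_const M \<nu> R \<beta>\<^sub>1 \<beta>\<^sub>2 * (N (g0 - u0) + N (g1 - u1)) powr (3 / 2)"
    by (simp only: anderson_const_def Let_def \<Gamma>_def K_def E_def A_def L_def S_def \<beta>\<^sub>0_def s_def
        y0_def y1_def mult.assoc)
  finally show ?thesis .
qed

end

section \<open>The space L2\<close>

text \<open>With pointwise scalar multiplication, sets of fields can be treated by
  \<open>subspace\<close>, \<open>span\<close> and the abstract locales.\<close>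

instantiation "fun" :: (type, real_vector) real_vector
begin

definition scaleR_fun_def: "r *\<^sub>R f = (\<lambda>x. r *\<^sub>R f x)"

instance
  by standard (simp_all add: scaleR_fun_def fun_eq_iff algebra_simps)

end

lemmas fun_arith = plus_fun_def fun_diff_def zero_fun_def scaleR_fun_def

lemma square_integrable_lin:
  fixes f g :: "'a::euclidean_space \<Rightarrow> 'b::euclidean_space"
  assumes f: "f square_integrable_on \<Omega>" and g: "g square_integrable_on \<Omega>"
  shows "(\<lambda>x. r *\<^sub>R f x + s *\<^sub>R g x) square_integrable_on \<Omega>"
proof -
  have [measurable]: "f \<in> borel_measurable (lebesgue_on \<Omega>)" "g \<in> borel_measurable (lebesgue_on \<Omega>)"
    using f g by (auto simp: square_integrable_on_def)
  have "integrable (lebesgue_on \<Omega>) (\<lambda>x. 2 * r\<^sup>2 * (norm (f x))\<^sup>2 + 2 * s\<^sup>2 * (norm (g x))\<^sup>2)"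
    using f g by (auto simp: square_integrable_on_def)
  moreover have "(norm (r *\<^sub>R f x + s *\<^sub>R g x))\<^sup>2 \<le> 2 * r\<^sup>2 * (norm (f x))\<^sup>2 + 2 * s\<^sup>2 * (norm (g x))\<^sup>2" for x
  proof -
    have "(norm (r *\<^sub>R f x + s *\<^sub>R g x))\<^sup>2 \<le> (\<bar>r\<bar> * norm (f x) + \<bar>s\<bar> * norm (g x))\<^sup>2"
      by (intro power_mono order_trans[OF norm_triangle_ineq]) auto
    also have "\<dots> \<le> 2 * (\<bar>r\<bar> * norm (f x))\<^sup>2 + 2 * (\<bar>s\<bar> * norm (g x))\<^sup>2"
      using sum_squares_bound[of "\<bar>r\<bar> * norm (f x)" "\<bar>s\<bar> * norm (g x)"] by (simp add: power2_sum)
    finally show ?thesis by (simp add: power_mult_distrib)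
  qed
  ultimately have "integrable (lebesgue_on \<Omega>) (\<lambda>x. (norm (r *\<^sub>R f x + s *\<^sub>R g x))\<^sup>2)"
    by (elim Bochner_Integration.integrable_bound) auto
  then show ?thesis by (simp add: square_integrable_on_def)
qed

lemma integrable_inner:
  fixes f g :: "'a::euclidean_space \<Rightarrow> 'b::euclidean_space"
  assumes f: "f square_integrable_on \<Omega>" and g: "g square_integrable_on \<Omega>"
  shows "integrable (lebesgue_on \<Omega>) (\<lambda>x. f x \<bullet> g x)"
proof -
  have [measurable]: "f \<in> borel_measurable (lebesgue_on \<Omega>)" "g \<in> borel_measurable (lebesgue_on \<Omega>)"
    using f g by (auto simp: square_integrable_on_def)
  have "integrable (lebesgue_on \<Omega>) (\<lambda>x. (norm (f x))\<^sup>2 + (norm (g x))\<^sup>2)"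
    using f g by (auto simp: square_integrable_on_def)
  moreover have "\<bar>f x \<bullet> g x\<bar> \<le> (norm (f x))\<^sup>2 + (norm (g x))\<^sup>2" for x
    using Cauchy_Schwarz_ineq2[of "f x" "g x"] sum_squares_bound[of "norm (f x)" "norm (g x)"]
      mult_nonneg_nonneg[OF norm_ge_zero[of "f x"] norm_ge_zero[of "g x"]]
    by linarith
  ultimately show ?thesis
    by (elim Bochner_Integration.integrable_bound) auto
qed

lemma square_integrable_inner_const:
  fixes g :: "'a::euclidean_space \<Rightarrow> 'b::euclidean_space"
  assumes g: "g square_integrable_on \<Omega>"
  shows "(\<lambda>x. g x \<bullet> c) square_integrable_on \<Omega>"
proof -
  have m[measurable]: "g \<in> borel_measurable (lebesgue_on \<Omega>)"
    using g by (simp add: square_integrable_on_def)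
  have "integrable (lebesgue_on \<Omega>) (\<lambda>x. (norm (g x))\<^sup>2 * (norm c)\<^sup>2)"
    using g by (simp add: square_integrable_on_def)
  moreover have "(g x \<bullet> c)\<^sup>2 \<le> (norm (g x))\<^sup>2 * (norm c)\<^sup>2" for x
    using Cauchy_Schwarz_ineq[of "g x" c] by (simp add: power2_norm_eq_inner)
  ultimately have "integrable (lebesgue_on \<Omega>) (\<lambda>x. (g x \<bullet> c)\<^sup>2)"
    by (elim Bochner_Integration.integrable_bound) auto
  then show ?thesis by (simp add: square_integrable_on_def)
qed

text \<open>Supplies the Cauchy-Schwarz and triangle inequalities for \<open>l2_norm\<close>. The
  gradient form on the discrete space is a second instance of the same locale.\<close>

interpretation l2: semi_inner_product "{f. f square_integrable_on \<Omega>}" "l2_inner \<Omega>"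
  for \<Omega> :: "'a::euclidean_space set"
proof
  show "subspace {f::'a \<Rightarrow> 'b. f square_integrable_on \<Omega>}"
  proof (rule subspaceI)
    show "0 \<in> {f::'a \<Rightarrow> 'b. f square_integrable_on \<Omega>}"
      by (simp add: square_integrable_on_def zero_fun_def)
    show "f + g \<in> {f. f square_integrable_on \<Omega>}"
      if "f \<in> {f. f square_integrable_on \<Omega>}" "g \<in> {f. f square_integrable_on \<Omega>}" for f g :: "'a \<Rightarrow> 'b"
      using square_integrable_lin[of f \<Omega> g 1 1] that by (simp add: plus_fun_def)
    show "c *\<^sub>R f \<in> {f. f square_integrable_on \<Omega>}"
      if "f \<in> {f. f square_integrable_on \<Omega>}" for c and f :: "'a \<Rightarrow> 'b"
      using square_integrable_lin[of f \<Omega> f c 0] that by (simp add: scaleR_fun_def)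
  qed
  show "l2_inner \<Omega> (r *\<^sub>R u + s *\<^sub>R v) w = r * l2_inner \<Omega> u w + s * l2_inner \<Omega> v w"
    if "u \<in> {f. f square_integrable_on \<Omega>}" "v \<in> {f. f square_integrable_on \<Omega>}"
      "w \<in> {f. f square_integrable_on \<Omega>}" for r s and u v w :: "'a \<Rightarrow> 'b"
    using that by (simp add: l2_inner_def fun_arith inner_add_left integrable_inner)
  show "l2_inner \<Omega> u v = l2_inner \<Omega> v u" for u v :: "'a \<Rightarrow> 'b"
    by (simp add: l2_inner_def inner_commute)
  show "0 \<le> l2_inner \<Omega> u u" for u :: "'a \<Rightarrow> 'b"
    by (simp add: l2_inner_def)
qed

lemma l2_N_eq: "l2.N \<Omega> f = l2_norm \<Omega> f"
  by (simp add: l2.N_def l2_norm_def)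

lemma square_integrable_continuous:
  fixes f :: "'a::euclidean_space \<Rightarrow> 'b::euclidean_space"
  assumes f: "continuous_on UNIV f" and \<Omega>: "\<Omega> \<in> sets lebesgue" "bounded \<Omega>"
  shows "f square_integrable_on \<Omega>"
proof -
  have "\<Omega> \<in> lmeasurable" using \<Omega> by (simp add: bounded_set_imp_lmeasurable)
  then interpret finite_measure "lebesgue_on \<Omega>"
    by (simp add: finite_measure_lebesgue_on)
  have m[measurable]: "f \<in> borel_measurable (lebesgue_on \<Omega>)"
    using f \<Omega>(1) continuous_on_subset by (blast intro: continuous_imp_measurable_on_sets_lebesgue)
  have "compact (f ` closure \<Omega>)"
    using f \<Omega> by (intro compact_continuous_image) (auto intro: continuous_on_subset)
  then obtain B where "\<forall>x\<in>closure \<Omega>. norm (f x) \<le> B"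
    by (meson compact_imp_bounded bounded_iff imageI)
  then have B: "norm (f x) \<le> B" if "x \<in> \<Omega>" for x
    using closure_subset that by blast
  have "integrable (lebesgue_on \<Omega>) (\<lambda>x. (norm (f x))\<^sup>2)"
    by (rule integrable_const_bound[where B = "B\<^sup>2"]) (auto intro!: AE_I2 power_mono B)
  then show ?thesis by (simp add: square_integrable_on_def)
qed

section \<open>Uniqueness of weak gradients\<close>

text \<open>By translation invariance every difference quotient in direction e has integral zero,
  and the quotients converge dominatedly to the derivative.\<close>

lemma integral_directional_derivative_zero:
  fixes F :: "'a::euclidean_space \<Rightarrow> real"
  assumes der: "\<And>x. (F has_derivative F' x) (at x)" and cont: "continuous_on UNIV (\<lambda>x. F' x e)"
    and K: "compact K" and zero: "\<And>x. x \<notin> K \<Longrightarrow> F x = 0"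
  shows "(LINT x|lborel. F' x e) = 0"
proof -
  define h where "h n = 1 / (real n + 1)" for n
  define q where "q n x = (F (x + h n *\<^sub>R e) - F x) / h n" for n x
  \<comment> \<open>For step lengths at most 1, the quotients vanish outside \<open>K1\<close>, and
    for x in \<open>K1\<close> the mean value theorem evaluates the derivative inside
    \<open>K2\<close>. Both sets are compact, which yields the dominating function.\<close>
  define K1 where "K1 = (\<lambda>(x, t). x - t *\<^sub>R e) ` (K \<times> {0..1})"
  define K2 where "K2 = (\<lambda>(x, t). x + t *\<^sub>R e) ` (K1 \<times> {0..1})"
  have h: "0 < h n" "h n \<le> 1" for n by (auto simp: h_def)
  have K1: "compact K1" unfolding K1_def case_prod_unfold
    by (intro compact_continuous_image compact_Times K continuous_intros compact_Icc)
  have "compact K2" unfolding K2_def case_prod_unfold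
    by (intro compact_continuous_image compact_Times K1 continuous_intros compact_Icc)
  then have "compact ((\<lambda>x. F' x e) ` K2)"
    using cont by (auto intro: compact_continuous_image continuous_on_subset)
  then obtain B where B: "\<bar>F' x e\<bar> \<le> B" if "x \<in> K2" for x
    by (metis compact_imp_bounded bounded_iff imageI real_norm_def)
  have contF: "continuous_on UNIV F"
    using der by (meson continuous_at_imp_continuous_on has_derivative_continuous)
  have mF[measurable]: "F \<in> borel_measurable borel"
    using contF by (rule borel_measurable_continuous_onI)
  have intF: "integrable lborel F"
  proof -
    have "(\<lambda>x. indicator K x *\<^sub>R F x) = F" using zero by (auto simp: indicator_def fun_eq_iff)
    then show ?thesis
      using borel_integrable_compact[OF K continuous_on_subset[OF contF]] by simp
  qed
  have line: "((\<lambda>t. F (x + t *\<^sub>R e)) has_real_derivative F' (x + t *\<^sub>R e) e) (at t)" for x t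
  proof -
    have "((\<lambda>t. F (x + t *\<^sub>R e)) has_derivative (\<lambda>s. F' (x + t *\<^sub>R e) (s *\<^sub>R e))) (at t)"
      by (rule has_derivative_compose[OF _ der]) (auto intro!: derivative_eq_intros)
    moreover have "F' (x + t *\<^sub>R e) (s *\<^sub>R e) = F' (x + t *\<^sub>R e) e * s" for s
      using linear_cmul[OF has_derivative_linear[OF der]] by simp
    ultimately show ?thesis by (simp add: has_field_derivative_def)
  qed
  have "(\<lambda>n. LINT x|lborel. q n x) \<longlonglongrightarrow> (LINT x|lborel. F' x e)"
  proof (rule integral_dominated_convergence[where w = "\<lambda>x. indicator K1 x *\<^sub>R B"])
    show "(\<lambda>x. F' x e) \<in> borel_measurable lborel"
      using borel_measurable_continuous_onI[OF cont] by simp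
    show "q n \<in> borel_measurable lborel" for n
      unfolding q_def by measurable
    show "integrable lborel (\<lambda>x. indicator K1 x *\<^sub>R B)"
      using borel_integrable_compact[OF K1, of "\<lambda>_. B"] by simp
    have "(\<lambda>n. q n x) \<longlonglongrightarrow> F' x e" for x
    proof -
      have "(\<lambda>s. (F (x + s *\<^sub>R e) - F x) / s) \<midarrow>0\<rightarrow> F' x e"
        using line[of x 0] by (simp add: DERIV_def)
      moreover have "filterlim h (at 0) sequentially"
        unfolding filterlim_at using h
        by (auto simp: h_def[abs_def] intro!: LIMSEQ_Suc[OF lim_1_over_n, simplified, simplified add.commute[of 1]] eventuallyI simp: less_imp_neq)
      ultimately show ?thesis
        unfolding q_def by (rule filterlim_compose)
    qed
    then show "AE x in lborel. (\<lambda>n. q n x) \<longlonglongrightarrow> F' x e" by simp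
    have "norm (q n x) \<le> indicator K1 x *\<^sub>R B" for n x
    proof (cases "x \<in> K1")
      case True
      obtain t where t: "0 < t" "t < h n"
        "F (x + h n *\<^sub>R e) - F (x + 0 *\<^sub>R e) = (h n - 0) * F' (x + t *\<^sub>R e) e"
        using MVT2[of 0 "h n" "\<lambda>t. F (x + t *\<^sub>R e)" "\<lambda>t. F' (x + t *\<^sub>R e) e"] h line by blast
      have "x + t *\<^sub>R e \<in> K2"
        using True t h[of n] by (auto simp: K2_def intro!: image_eqI[where x = "(x, t)"])
      moreover have "q n x = F' (x + t *\<^sub>R e) e"
        using t h[of n] by (simp add: q_def)
      ultimately show ?thesis using B True by simp
    next
      case False
      have "x \<notin> K"
        using False by (force simp: K1_def intro: image_eqI[where x = "(x, 0)"])
      moreover have "x + h n *\<^sub>R e \<notin> K"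
      proof
        assume "x + h n *\<^sub>R e \<in> K"
        then have "x \<in> K1"
          using h[of n] by (auto simp: K1_def less_imp_le intro!: image_eqI[where x = "(x + h n *\<^sub>R e, h n)"])
        then show False using False by simp
      qed
      ultimately show ?thesis using False by (simp add: q_def zero)
    qed
    then show "AE x in lborel. norm (q n x) \<le> indicator K1 x *\<^sub>R B" for n by simp
  qed
  moreover have "(LINT x|lborel. q n x) = 0" for n
  proof -
    let ?c = "h n *\<^sub>R e"
    have i: "integrable lborel (\<lambda>x. F (?c + x))"
      using intF by (subst (asm) lborel_distr_plus[of ?c, symmetric]) (simp add: integrable_distr_eq)
    have "(LINT x|lborel. F (?c + x)) = (LINT x|distr lborel borel ((+) ?c). F x)"
      by (simp add: integral_distr)
    then have "(LINT x|lborel. F (?c + x)) = (LINT x|lborel. F x)"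
      by (simp add: lborel_distr_plus)
    then show ?thesis using i intF by (simp add: q_def add.commute)
  qed
  ultimately show ?thesis
    using LIMSEQ_unique[OF _ tendsto_const] by fastforce
qed

section \<open>Integration by parts against polynomials\<close>

lemma real_polynomial_function_C1:
  assumes "real_polynomial_function p"
  shows "\<exists>p'. (\<forall>x. (p has_derivative p' x) (at x)) \<and> (\<forall>e. continuous_on UNIV (\<lambda>x. p' x e))"
  using assms
proof induction
  case (linear f)
  then show ?case
    by (intro exI[of _ "\<lambda>_. f"]) (auto intro: bounded_linear_imp_has_derivative)
next
  case (const c)
  then show ?case by (intro exI[of _ "\<lambda>_ _. 0"]) auto
next
  case (add f g)
  then obtain f' g' where "\<forall>x. (f has_derivative f' x) (at x)" "\<forall>e. continuous_on UNIV (\<lambda>x. f' x e)"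
    "\<forall>x. (g has_derivative g' x) (at x)" "\<forall>e. continuous_on UNIV (\<lambda>x. g' x e)" by blast
  then show ?case
    by (intro exI[of _ "\<lambda>x h. f' x h + g' x h"])
      (auto intro!: has_derivative_add continuous_intros)
next
  case (mult f g)
  then obtain f' g' where f': "\<forall>x. (f has_derivative f' x) (at x)" "\<forall>e. continuous_on UNIV (\<lambda>x. f' x e)"
    "\<forall>x. (g has_derivative g' x) (at x)" "\<forall>e. continuous_on UNIV (\<lambda>x. g' x e)" by blast
  then have "continuous_on UNIV f" "continuous_on UNIV g"
    by (meson continuous_at_imp_continuous_on has_derivative_continuous)+
  with f' show ?case
    by (intro exI[of _ "\<lambda>x h. f x * g' x h + f' x h * g x"])
      (auto intro!: has_derivative_mult continuous_intros)
qed

lemma test_function_has_derivative: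
  assumes "test_function \<Omega> \<phi>"
  shows "(\<phi> has_derivative frechet_derivative \<phi> (at x)) (at x)"
  using assms unfolding frechet_derivative_works[symmetric]
  by (auto simp: test_function_def smooth_on_def dest!: spec[where x = "[]"])

lemma test_function_continuous:
  assumes "test_function \<Omega> \<phi>"
  shows "continuous_on UNIV \<phi>"
  using test_function_has_derivative[OF assms]
  by (meson continuous_at_imp_continuous_on has_derivative_continuous)

lemma test_function_continuous_derivative:
  assumes "test_function \<Omega> \<phi>"
  shows "continuous_on UNIV (\<lambda>x. frechet_derivative \<phi> (at x) e)"
proof -
  have "iter_deriv [e] \<phi> differentiable (at x)" for x
    using assms by (simp add: test_function_def smooth_on_def del: iter_deriv.simps)
  then show ?thesis
    by (auto intro!: continuous_at_imp_continuous_on differentiable_imp_continuous_within)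
qed

lemma matrix_nth: "matrix f $ i $ j = f (axis j 1) $ i"
  by (simp add: matrix_def)

lemma test_function_continuous_matrix:
  fixes \<phi> :: "'n::finite vfield"
  assumes "test_function \<Omega> \<phi>"
  shows "continuous_on UNIV (\<lambda>x. matrix (frechet_derivative \<phi> (at x)))"
  unfolding matrix_def
  by (intro continuous_on_vec_lambda continuous_on_component test_function_continuous_derivative[OF assms])

text \<open>Lets integrals over the domain be exchanged with integrals over the whole space.\<close>

lemma test_function_outside:
  assumes "test_function \<Omega> \<phi>" "x \<notin> \<Omega>"
  shows "\<phi> x = 0" "frechet_derivative \<phi> (at x) = (\<lambda>_. 0)"
proof -
  let ?K = "closure {x. \<phi> x \<noteq> 0}"
  have K: "x \<in> - ?K" "open (- ?K)" using assms by (auto simp: test_function_def)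
  have zero: "\<phi> y = 0" if "y \<in> - ?K" for y
  proof -
    have "y \<notin> {x. \<phi> x \<noteq> 0}" using that subsetD[OF closure_subset[of "{x. \<phi> x \<noteq> 0}"]] by (meson ComplD)
    then show ?thesis by simp
  qed
  show "\<phi> x = 0" by (rule zero[OF K(1)])
  have "(\<phi> has_derivative (\<lambda>_. 0)) (at x)"
    by (rule has_derivative_transform_within_open[OF has_derivative_const K(2,1)]) (rule zero[symmetric])
  then show "frechet_derivative \<phi> (at x) = (\<lambda>_. 0)"
    by (rule frechet_derivative_at[symmetric])
qed

text \<open>The test field alone makes the product compactly supported, so p may be any C1
  multiplier, in particular a polynomial, and no boundary term arises.\<close>

lemma test_function_integration_by_parts:
  fixes \<phi> :: "'n::finite vfield"
  assumes \<phi>: "test_function \<Omega> \<phi>" and \<Omega>: "\<Omega> \<in> sets lebesgue" "bounded \<Omega>"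
    and p: "\<And>x. (p has_derivative p' x) (at x)" "\<And>e. continuous_on UNIV (\<lambda>x. p' x e)"
  shows "(LINT x|lebesgue_on \<Omega>. matrix (frechet_derivative \<phi> (at x)) $ i $ j * p x)
    = - (LINT x|lebesgue_on \<Omega>. \<phi> x $ i * p' x (axis j 1))"
proof -
  let ?F = "\<lambda>x. \<phi> x $ i * p x"
  let ?F' = "\<lambda>x h. \<phi> x $ i * p' x h + frechet_derivative \<phi> (at x) h $ i * p x"
  let ?e = "axis j 1 :: real^'n"
  have contp: "continuous_on UNIV p"
    using p(1) by (meson continuous_at_imp_continuous_on has_derivative_continuous)
  note cont = continuous_on_component[OF test_function_continuous[OF \<phi>]]
    continuous_on_component[OF test_function_continuous_derivative[OF \<phi>]]
  have cont': "continuous_on UNIV (\<lambda>x. ?F' x ?e)"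
    by (intro continuous_intros cont contp p)
  have "(LINT x|lborel. ?F' x ?e) = 0"
  proof (rule integral_directional_derivative_zero[where K = "closure {x. \<phi> x \<noteq> 0}"])
    show "(?F has_derivative ?F' x) (at x)" for x
      by (intro has_derivative_mult p
          bounded_linear.has_derivative[OF bounded_linear_vec_nth test_function_has_derivative[OF \<phi>]])
    show "compact (closure {x. \<phi> x \<noteq> 0})" using \<phi> by (simp add: test_function_def)
    show "?F x = 0" if "x \<notin> closure {x. \<phi> x \<noteq> 0}" for x
    proof -
      have "x \<notin> {x. \<phi> x \<noteq> 0}" using that subsetD[OF closure_subset[of "{x. \<phi> x \<noteq> 0}"]] by (meson ComplD)
      then show ?thesis by simp
    qed
  qed (rule cont')
  then have "(LINT x|lebesgue. ?F' x ?e) = 0"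
    using borel_measurable_continuous_onI[OF cont'] by (subst integral_completion) simp_all
  moreover have "(LINT x|lebesgue_on \<Omega>. ?F' x ?e) = (LINT x|lebesgue. ?F' x ?e)"
  proof -
    have ind: "indicator \<Omega> x *\<^sub>R ?F' x ?e = ?F' x ?e" for x
      using test_function_outside[OF \<phi>, of x] by (cases "x \<in> \<Omega>") simp_all
    have "\<Omega> \<inter> space lebesgue \<in> sets lebesgue" using \<Omega>(1) by simp
    then show ?thesis by (simp only: integral_restrict_space ind)
  qed
  ultimately have "(LINT x|lebesgue_on \<Omega>. ?F' x ?e) = 0" by simp
  moreover have "integrable (lebesgue_on \<Omega>) (\<lambda>x. \<phi> x $ i * p' x ?e)"
    "integrable (lebesgue_on \<Omega>) (\<lambda>x. frechet_derivative \<phi> (at x) ?e $ i * p x)"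
    using integrable_inner[OF square_integrable_continuous[OF cont(1) \<Omega>] square_integrable_continuous[OF p(2) \<Omega>]]
      integrable_inner[OF square_integrable_continuous[OF cont(2) \<Omega>] square_integrable_continuous[OF contp \<Omega>]]
    by simp_all
  ultimately show ?thesis by (simp add: matrix_nth)
qed

lemma l2_inner_tendsto:
  fixes f :: "nat \<Rightarrow> 'a::euclidean_space \<Rightarrow> 'b::euclidean_space"
  assumes f: "\<And>n. f n square_integrable_on \<Omega>" and g: "g square_integrable_on \<Omega>"
    and h: "h square_integrable_on \<Omega>" and lim: "(\<lambda>n. l2_norm \<Omega> (\<lambda>x. f n x - g x)) \<longlonglongrightarrow> 0"
  shows "(\<lambda>n. l2_inner \<Omega> (f n) h) \<longlonglongrightarrow> l2_inner \<Omega> g h"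
proof (rule LIM_zero_cancel, rule Lim_null_comparison)
  have "\<bar>l2_inner \<Omega> (f n - g) h\<bar> \<le> l2_norm \<Omega> (f n - g) * l2_norm \<Omega> h" for n
    using l2.D_le[of "f n - g" \<Omega> h] l2.V_diff[of "f n" \<Omega> g] f g h by (simp add: l2_N_eq)
  then show "\<forall>\<^sub>F n in sequentially. norm (l2_inner \<Omega> (f n) h - l2_inner \<Omega> g h)
      \<le> l2_norm \<Omega> (\<lambda>x. f n x - g x) * l2_norm \<Omega> h"
    using l2.D_simps(2)[of _ \<Omega> g h] f g h by (simp add: fun_diff_def)
  show "(\<lambda>n. l2_norm \<Omega> (\<lambda>x. f n x - g x) * l2_norm \<Omega> h) \<longlonglongrightarrow> 0"
    using tendsto_mult_left_zero[OF lim] .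
qed

lemma matrix_inner_entry:
  fixes A :: "real^'n^'m"
  shows "A \<bullet> axis i (axis j c) = A $ i $ j * c"
  by (simp add: inner_axis)

lemma continuous_on_axis:
  fixes f :: "'a::topological_space \<Rightarrow> 'b::{real_normed_vector}"
  assumes "continuous_on S f"
  shows "continuous_on S (\<lambda>x. axis i (f x))"
  unfolding axis_def
proof (rule continuous_on_vec_lambda)
  show "continuous_on S (\<lambda>x. if j = i then f x else 0)" for j
    using assms by (cases "j = i") auto
qed

text \<open>Both sides are continuous in L2, so the identity passes from the approximating test
  fields to their limit.\<close>

lemma H10_gradient_integration_by_parts:
  assumes vg: "H10_gradient \<Omega> v g" and \<Omega>: "\<Omega> \<in> sets lebesgue" "bounded \<Omega>"
    and p: "\<And>x. (p has_derivative p' x) (at x)" "\<And>e. continuous_on UNIV (\<lambda>x. p' x e)"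
  shows "(LINT x|lebesgue_on \<Omega>. g x $ i $ j * p x) = - (LINT x|lebesgue_on \<Omega>. v x $ i * p' x (axis j 1))"
proof -
  have v: "v square_integrable_on \<Omega>" and g: "g square_integrable_on \<Omega>"
    using vg by (auto simp: H10_gradient_def)
  obtain \<phi> where \<phi>: "\<And>n. test_function \<Omega> (\<phi> n)"
    and lim: "(\<lambda>n. l2_norm \<Omega> (\<lambda>x. \<phi> n x - v x)) \<longlonglongrightarrow> 0"
    "(\<lambda>n. l2_norm \<Omega> (\<lambda>x. matrix (frechet_derivative (\<phi> n) (at x)) - g x)) \<longlonglongrightarrow> 0"
    using vg by (auto simp: H10_gradient_def)
  \<comment> \<open>Placing the multiplier in a single entry turns entrywise integrals into L2
    products of whole fields.\<close>
  let ?P = "\<lambda>x. axis i (axis j (p x))" and ?P' = "\<lambda>x. axis i (p' x (axis j 1))"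
  have contp: "continuous_on UNIV p"
    using p(1) by (meson continuous_at_imp_continuous_on has_derivative_continuous)
  have "continuous_on UNIV ?P" "continuous_on UNIV ?P'"
    by (intro continuous_on_axis contp p(2))+
  then have P: "?P square_integrable_on \<Omega>" "?P' square_integrable_on \<Omega>"
    using \<Omega> by (auto intro: square_integrable_continuous)
  have 1: "(\<lambda>n. l2_inner \<Omega> (\<lambda>x. matrix (frechet_derivative (\<phi> n) (at x))) ?P) \<longlonglongrightarrow> l2_inner \<Omega> g ?P"
    by (rule l2_inner_tendsto[OF square_integrable_continuous[OF test_function_continuous_matrix[OF \<phi>] \<Omega>] g P(1) lim(2)])
  have 2: "(\<lambda>n. l2_inner \<Omega> (\<phi> n) ?P') \<longlonglongrightarrow> l2_inner \<Omega> v ?P'"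
    by (rule l2_inner_tendsto[OF square_integrable_continuous[OF test_function_continuous[OF \<phi>] \<Omega>] v P(2) lim(1)])
  have "l2_inner \<Omega> (\<lambda>x. matrix (frechet_derivative (\<phi> n) (at x))) ?P = - l2_inner \<Omega> (\<phi> n) ?P'" for n
    using test_function_integration_by_parts[OF \<phi>[of n] \<Omega> p]
    by (simp add: l2_inner_def matrix_inner_entry inner_axis)
  then have "l2_inner \<Omega> g ?P = - l2_inner \<Omega> v ?P'"
    using LIMSEQ_unique[OF 1] tendsto_minus[OF 2] by simp
  then show ?thesis by (simp add: l2_inner_def matrix_inner_entry inner_axis)
qed

section \<open>Polynomials separate square integrable functions\<close>

lemma zero_if_le_multiples:
  fixes X c :: real
  assumes "\<And>e. e > 0 \<Longrightarrow> \<bar>X\<bar> \<le> e * c"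
  shows "X = 0"
proof -
  have "((\<lambda>e. e * c) \<longlongrightarrow> 0 * c) (at_right 0)"
    by (intro tendsto_intros)
  moreover have "\<forall>\<^sub>F e in at_right 0. \<bar>X\<bar> \<le> e * c"
    using assms by (auto intro: eventually_at_rightI[of 0 1])
  ultimately have "\<bar>X\<bar> \<le> 0 * c"
    by (rule tendsto_lowerbound) simp
  then show ?thesis by simp
qed

text \<open>Orthogonality is extended from polynomials to continuous functions, then to indicators
  of open sets, then to indicators of all measurable sets, where it forces h to vanish almost
  everywhere.\<close>

lemma AE_zero_if_orthogonal_to_polynomials:
  fixes h :: "'a::euclidean_space \<Rightarrow> real"
  assumes h: "h square_integrable_on \<Omega>" and \<Omega>: "\<Omega> \<in> sets lebesgue" "bounded \<Omega>"
    and orth: "\<And>p. real_polynomial_function p \<Longrightarrow> (LINT x|lebesgue_on \<Omega>. h x * p x) = 0"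
  shows "AE x in lebesgue_on \<Omega>. h x = 0"
proof -
  have mh[measurable]: "h \<in> borel_measurable (lebesgue_on \<Omega>)"
    using h by (simp add: square_integrable_on_def)
  have fin: "\<Omega> \<in> lmeasurable" using \<Omega> by (simp add: bounded_set_imp_lmeasurable)
  have sq: "q square_integrable_on \<Omega>" if "continuous_on UNIV q" for q :: "'a \<Rightarrow> real"
    using square_integrable_continuous[OF that \<Omega>] .
  have int: "integrable (lebesgue_on \<Omega>) (\<lambda>x. h x * q x)" if "continuous_on UNIV q" for q
    using integrable_inner[OF h sq[OF that]] by simp
  have inth: "integrable (lebesgue_on \<Omega>) h" using int[of "\<lambda>_. 1"] by simp
  \<comment> \<open>Stone-Weierstrass on the compact closure; the uniform error is integrated
    against |h|.\<close>
  have cont0: "(LINT x|lebesgue_on \<Omega>. h x * q x) = 0" if q: "continuous_on UNIV q" for q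
  proof -
    let ?I = "LINT x|lebesgue_on \<Omega>. \<bar>h x\<bar>"
    have "\<bar>LINT x|lebesgue_on \<Omega>. h x * q x\<bar> \<le> e * ?I" if e: "e > 0" for e
    proof -
      obtain p where p: "real_polynomial_function p" "\<And>x. x \<in> closure \<Omega> \<Longrightarrow> \<bar>q x - p x\<bar> < e"
        using Stone_Weierstrass_real_polynomial_function[of "closure \<Omega>" q e] \<Omega> q e
        by (metis compact_closure continuous_on_subset subset_UNIV)
      have contp: "continuous_on UNIV p"
        using p(1) by (simp add: continuous_on_polymonial_function real_polynomial_function_eq)
      have "(LINT x|lebesgue_on \<Omega>. h x * q x) = (LINT x|lebesgue_on \<Omega>. h x * (q x - p x))"
        using int[OF q] int[OF contp] orth[OF p(1)] by (simp add: right_diff_distrib)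
      also have "\<bar>\<dots>\<bar> \<le> (LINT x|lebesgue_on \<Omega>. \<bar>h x\<bar> * e)"
      proof (rule order_trans[OF integral_abs_bound integral_mono])
        show "integrable (lebesgue_on \<Omega>) (\<lambda>x. \<bar>h x * (q x - p x)\<bar>)"
          using int[OF continuous_on_diff[OF q contp]] by simp
        show "integrable (lebesgue_on \<Omega>) (\<lambda>x. \<bar>h x\<bar> * e)" using inth by simp
        show "\<bar>h x * (q x - p x)\<bar> \<le> \<bar>h x\<bar> * e" if "x \<in> space (lebesgue_on \<Omega>)" for x
          using p(2)[of x] that closure_subset[of \<Omega>] unfolding abs_mult
          by (intro mult_left_mono) (auto simp: less_imp_le)
      qed
      finally show ?thesis by (simp add: mult.commute)
    qed
    then show ?thesis by (rule zero_if_le_multiples)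
  qed
  have open0: "(LINT x|lebesgue_on \<Omega>. h x * indicator U x) = 0" if U: "open U" for U
  \<comment> \<open>The whole space is separate because \<open>infdist\<close> to the empty set is
    0, which would make the ramps below vanish.\<close>
  proof (cases "U = UNIV")
    case True
    then show ?thesis using cont0[of "\<lambda>_. 1"] by simp
  next
    case False
    \<comment> \<open>Continuous ramps that tend pointwise to the indicator of U.\<close>
    define \<psi> where "\<psi> n x = min 1 (real n * infdist x (- U))" for n x
    have \<psi>0: "0 \<le> \<psi> n x" "\<psi> n x \<le> 1" for n x by (auto simp: \<psi>_def infdist_nonneg)
    have cont\<psi>: "continuous_on UNIV (\<psi> n)" for n
      unfolding \<psi>_def by (intro continuous_intros)
    have lim: "(\<lambda>n. \<psi> n x) \<longlonglongrightarrow> indicator U x" for x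
    proof (cases "x \<in> U")
      case True
      then have pos: "infdist x (- U) > 0"
        using U False infdist_pos_not_in_closed[of "- U" x] by auto
      have "\<forall>\<^sub>F n in sequentially. 1 \<le> real n * infdist x (- U)"
        using eventually_ge_at_top[of "nat \<lceil>1 / infdist x (- U)\<rceil>"]
      proof eventually_elim
        case (elim n)
        then have "1 / infdist x (- U) \<le> real n" by linarith
        then show ?case using pos by (simp add: field_simps)
      qed
      then have "\<forall>\<^sub>F n in sequentially. \<psi> n x = 1"
        by eventually_elim (simp add: \<psi>_def)
      then show ?thesis using True by (simp add: tendsto_eventually)
    next
      case F: False
      then show ?thesis by (simp add: \<psi>_def)
    qed
    have "(\<lambda>n. LINT x|lebesgue_on \<Omega>. h x * \<psi> n x) \<longlonglongrightarrow> (LINT x|lebesgue_on \<Omega>. h x * indicator U x)"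
    proof (rule integral_dominated_convergence[where w = "\<lambda>x. \<bar>h x\<bar>"])
      have "U \<inter> space (lebesgue_on \<Omega>) \<in> sets (lebesgue_on \<Omega>)"
        using U \<Omega> by (auto simp: sets_restrict_space_iff)
      then have "indicat_real U \<in> borel_measurable (lebesgue_on \<Omega>)"
        by (simp add: borel_measurable_indicator_iff)
      then show "(\<lambda>x. h x * indicator U x) \<in> borel_measurable (lebesgue_on \<Omega>)" by measurable
      show "(\<lambda>x. h x * \<psi> n x) \<in> borel_measurable (lebesgue_on \<Omega>)" for n
        using int[OF cont\<psi>] by blast
      show "integrable (lebesgue_on \<Omega>) (\<lambda>x. \<bar>h x\<bar>)" using inth by simp
      show "AE x in lebesgue_on \<Omega>. (\<lambda>n. h x * \<psi> n x) \<longlonglongrightarrow> h x * indicator U x"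
        using lim by (intro AE_I2 tendsto_intros)
      show "AE x in lebesgue_on \<Omega>. norm (h x * \<psi> n x) \<le> \<bar>h x\<bar>" for n
        using \<psi>0 by (intro AE_I2) (simp add: abs_mult mult_left_le)
    qed
    then show ?thesis by (simp add: cont0[OF cont\<psi>] LIMSEQ_const_iff)
  qed
  have "AE x in lebesgue_on \<Omega>. h x = (\<lambda>_. 0) x"
  proof (rule density_unique_real[OF inth])
    fix A assume "A \<in> sets (lebesgue_on \<Omega>)"
    then have A: "A \<subseteq> \<Omega>" "A \<in> sets lebesgue" using \<Omega> by (auto simp: sets_restrict_space_iff)
    have "\<bar>LINT x|lebesgue_on \<Omega>. h x * indicator A x\<bar> \<le> d * l2_norm \<Omega> h" if d: "d > 0" for d
    proof -
      \<comment> \<open>The excess U - A has measure below d^2, so its indicator has L2 norm at most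
        d. Cauchy-Schwarz then bounds the error of replacing A by U, whose integral is zero.\<close>
      obtain U where U: "open U" "A \<subseteq> U" "U - A \<in> lmeasurable" "emeasure lebesgue (U - A) < ennreal (d\<^sup>2)"
        using sets_lebesgue_outer_open[OF A(2), of "d\<^sup>2"] d by auto
      define B where "B = (U - A) \<inter> \<Omega>"
      have B: "B \<subseteq> \<Omega>" "B \<in> sets lebesgue" using U \<Omega> by (auto simp: B_def fmeasurableD)
      let ?i = "indicat_real B"
      have ii: "(norm (?i x))\<^sup>2 = ?i x" "?i x \<bullet> ?i x = ?i x" for x
        by (simp_all add: indicator_def)
      have S: "B \<in> sets (lebesgue_on \<Omega>)"
        using B \<Omega> by (simp add: sets_restrict_space_iff)
      have int_i: "integrable (lebesgue_on \<Omega>) ?i"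
        using S integrable_real_indicator[of B "lebesgue_on \<Omega>"]
          finite_measure.emeasure_finite[OF finite_measure_lebesgue_on[OF fin]]
        by (simp add: top.not_eq_extremum)
      have sq_i: "?i square_integrable_on \<Omega>"
        using int_i by (simp only: square_integrable_on_def ii borel_measurable_integrable simp_thms)
      have "l2_norm \<Omega> ?i = sqrt (LINT x|lebesgue_on \<Omega>. ?i x)"
        by (simp only: l2_norm_def l2_inner_def ii)
      also have "\<dots> = sqrt (measure (lebesgue_on \<Omega>) B)"
        using B by (simp add: Int_absorb2)
      also have "\<dots> \<le> sqrt (d\<^sup>2)"
      proof -
        have "measure (lebesgue_on \<Omega>) B = measure lebesgue B"
          using \<Omega> B by (intro measure_restrict_space) auto
        also have "\<dots> \<le> measure lebesgue (U - A)"
          using U \<Omega> by (intro measure_mono_fmeasurable) (auto simp: fmeasurableD B_def)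
        also have "\<dots> \<le> d\<^sup>2"
          using U(3,4) by (simp add: fmeasurable_def emeasure_eq_ennreal_measure ennreal_less_iff less_imp_le less_top)
        finally show ?thesis by (rule real_sqrt_le_mono)
      qed
      finally have i: "l2_norm \<Omega> ?i \<le> d" using d by simp
      have int_U: "integrable (lebesgue_on \<Omega>) (\<lambda>x. h x * indicator U x)"
      proof (rule Bochner_Integration.integrable_bound[OF inth])
        have "U \<inter> space (lebesgue_on \<Omega>) \<in> sets (lebesgue_on \<Omega>)"
          using U \<Omega> by (auto simp: sets_restrict_space_iff)
        then have "indicat_real U \<in> borel_measurable (lebesgue_on \<Omega>)"
          by (simp add: borel_measurable_indicator_iff)
        then show "(\<lambda>x. h x * indicator U x) \<in> borel_measurable (lebesgue_on \<Omega>)" by measurable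
      qed (simp add: indicator_def)
      have "(LINT x|lebesgue_on \<Omega>. h x * indicator A x)
          = (LINT x|lebesgue_on \<Omega>. h x * indicator U x - h x * ?i x)"
        using U(2) by (intro Bochner_Integration.integral_cong) (auto simp: indicator_def B_def)
      also have "\<dots> = - l2_inner \<Omega> h ?i"
        by (subst Bochner_Integration.integral_diff[OF int_U integrable_inner[OF h sq_i, unfolded inner_real_def]])
          (simp add: open0[OF U(1)] l2_inner_def)
      also have "\<bar>\<dots>\<bar> \<le> l2_norm \<Omega> h * l2_norm \<Omega> ?i"
        using l2.D_le[of h \<Omega> ?i] h sq_i by (simp add: l2_N_eq)
      also have "\<dots> \<le> l2_norm \<Omega> h * d"
        using i l2.N_nonneg[of h \<Omega>] h by (intro mult_left_mono) (auto simp: l2_N_eq)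
      finally show ?thesis by (simp only: mult.commute)
    qed
    then have "(LINT x|lebesgue_on \<Omega>. h x * indicator A x) = 0"
      by (rule zero_if_le_multiples)
    then show "(LINT x:A|lebesgue_on \<Omega>. h x) = (LINT x:A|lebesgue_on \<Omega>. 0)"
      by (simp add: set_lebesgue_integral_def mult.commute)
  qed simp
  then show ?thesis by simp
qed

text \<open>After integration by parts only v and w appear, and they agree almost everywhere; so
  each entry of g - h is orthogonal to every polynomial. Taking w = 0 shows that a field vanishing
  in L2 has vanishing gradient.\<close>

lemma H10_gradient_unique:
  fixes v w :: "'a::finite vfield"
  assumes vg: "H10_gradient \<Omega> v g" "H10_gradient \<Omega> w h" and eq: "AE x in lebesgue_on \<Omega>. v x = w x"
    and \<Omega>: "\<Omega> \<in> sets lebesgue" "bounded \<Omega>"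
  shows "AE x in lebesgue_on \<Omega>. g x = h x"
proof -
  have sq: "g square_integrable_on \<Omega>" "h square_integrable_on \<Omega>"
    "v square_integrable_on \<Omega>" "w square_integrable_on \<Omega>"
    using vg by (auto simp: H10_gradient_def)
  have "AE x in lebesgue_on \<Omega>. (g x - h x) $ i $ j = 0" for i j
  proof (rule AE_zero_if_orthogonal_to_polynomials[OF _ \<Omega>])
    have "(\<lambda>x. g x - h x) square_integrable_on \<Omega>"
      using square_integrable_lin[OF sq(1,2), of 1 "-1"] by simp
    then show "(\<lambda>x. (g x - h x) $ i $ j) square_integrable_on \<Omega>"
      using square_integrable_inner_const[of "\<lambda>x. g x - h x" \<Omega> "axis i (axis j 1)"]
      by (simp only: matrix_inner_entry mult_1_right)
  next
    fix p :: "real^'a \<Rightarrow> real" assume "real_polynomial_function p"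
    then obtain p' where p: "\<And>x. (p has_derivative p' x) (at x)" "\<And>e. continuous_on UNIV (\<lambda>x. p' x e)"
      using real_polynomial_function_C1 by blast
    have contp: "continuous_on UNIV p"
      using p(1) by (meson continuous_at_imp_continuous_on has_derivative_continuous)
    have "continuous_on UNIV (\<lambda>x. axis i (axis j (p x)) :: real^'a^'a)"
      by (intro continuous_on_axis contp)
    then have P: "(\<lambda>x. axis i (axis j (p x)) :: real^'a^'a) square_integrable_on \<Omega>"
      using \<Omega> by (auto intro: square_integrable_continuous)
    have "(LINT x|lebesgue_on \<Omega>. v x $ i * p' x (axis j 1)) = (LINT x|lebesgue_on \<Omega>. w x $ i * p' x (axis j 1))"
    proof (rule integral_cong_AE)
      show "AE x in lebesgue_on \<Omega>. v x $ i * p' x (axis j 1) = w x $ i * p' x (axis j 1)"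
        using eq by eventually_elim simp
      have "continuous_on UNIV (\<lambda>x. axis i (p' x (axis j 1)) :: real^'a)"
        by (intro continuous_on_axis p)
      then have "(\<lambda>x. axis i (p' x (axis j 1)) :: real^'a) square_integrable_on \<Omega>"
        using \<Omega> by (auto intro: square_integrable_continuous)
      from integrable_inner[OF sq(3) this] integrable_inner[OF sq(4) this]
      show "(\<lambda>x. v x $ i * p' x (axis j 1)) \<in> borel_measurable (lebesgue_on \<Omega>)"
        "(\<lambda>x. w x $ i * p' x (axis j 1)) \<in> borel_measurable (lebesgue_on \<Omega>)"
        by (auto simp: inner_axis)
    qed
    then show "(LINT x|lebesgue_on \<Omega>. (g x - h x) $ i $ j * p x) = 0"
      using H10_gradient_integration_by_parts[OF vg(1) \<Omega> p] H10_gradient_integration_by_parts[OF vg(2) \<Omega> p]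
        integrable_inner[OF sq(1) P] integrable_inner[OF sq(2) P]
      by (simp add: left_diff_distrib matrix_inner_entry)
  qed
  then have "AE x in lebesgue_on \<Omega>. \<forall>i j. (g x - h x) $ i $ j = 0"
    by (simp add: AE_all_countable)
  then show ?thesis by eventually_elim (simp add: vec_eq_iff)
qed

section \<open>Linearity of the gradient and the trilinear form\<close>

lemma iter_deriv_lin:
  assumes f: "smooth_on UNIV f" and g: "smooth_on UNIV g"
  shows "iter_deriv es (\<lambda>x. r *\<^sub>R f x + s *\<^sub>R g x) = (\<lambda>x. r *\<^sub>R iter_deriv es f x + s *\<^sub>R iter_deriv es g x)"
proof (induction es)
  case (Cons e es)
  have "(iter_deriv es f has_derivative frechet_derivative (iter_deriv es f) (at x)) (at x)"
    "(iter_deriv es g has_derivative frechet_derivative (iter_deriv es g) (at x)) (at x)" for x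
    using f g by (simp_all add: smooth_on_def flip: frechet_derivative_works)
  then have "((\<lambda>x. r *\<^sub>R iter_deriv es f x + s *\<^sub>R iter_deriv es g x) has_derivative
      (\<lambda>h. r *\<^sub>R frechet_derivative (iter_deriv es f) (at x) h
        + s *\<^sub>R frechet_derivative (iter_deriv es g) (at x) h)) (at x)" for x
    by (intro has_derivative_add has_derivative_scaleR_right)
  from frechet_derivative_at[OF this, symmetric] show ?case by (simp add: Cons)
qed simp

lemma iter_deriv_zero: "iter_deriv es (\<lambda>_. 0) = (\<lambda>_. 0)"
  by (induction es) (simp_all add: frechet_derivative_const)

lemma test_function_zero: "test_function \<Omega> (\<lambda>_. 0)"
  by (simp add: test_function_def smooth_on_def iter_deriv_zero)

lemma test_function_lin:
  assumes \<phi>: "test_function \<Omega> \<phi>" and \<psi>: "test_function \<Omega> \<psi>"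
  shows "test_function \<Omega> (\<lambda>x. r *\<^sub>R \<phi> x + s *\<^sub>R \<psi> x)"
proof -
  let ?S = "\<lambda>f. closure {x. f x \<noteq> 0}"
  let ?\<chi> = "\<lambda>x. r *\<^sub>R \<phi> x + s *\<^sub>R \<psi> x"
  have "?S ?\<chi> \<subseteq> closure ({x. \<phi> x \<noteq> 0} \<union> {x. \<psi> x \<noteq> 0})"
    by (rule closure_mono) auto
  then have S: "?S ?\<chi> \<subseteq> ?S \<phi> \<union> ?S \<psi>"
    by (simp only: closure_Un)
  have sub: "?S \<phi> \<union> ?S \<psi> \<subseteq> \<Omega>" and c: "compact (?S \<phi> \<union> ?S \<psi>)"
    using \<phi> \<psi> by (simp_all add: test_function_def compact_Un)
  have "?S ?\<chi> \<subseteq> \<Omega>"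
    using S sub by (rule order_trans)
  moreover have "compact (?S ?\<chi>)"
    using compact_Int_closed[OF c closed_closure[of "{x. ?\<chi> x \<noteq> 0}"]] S by (simp only: Int_absorb1)
  moreover have "smooth_on UNIV ?\<chi>"
    using \<phi> \<psi> by (auto simp: test_function_def iter_deriv_lin smooth_on_def intro!: derivative_intros)
  ultimately show ?thesis by (simp add: test_function_def)
qed

lemma frechet_matrix_lin:
  assumes "test_function \<Omega> \<phi>" "test_function \<Omega> \<psi>"
  shows "matrix (frechet_derivative (\<lambda>x. r *\<^sub>R \<phi> x + s *\<^sub>R \<psi> x) (at x))
    = r *\<^sub>R matrix (frechet_derivative \<phi> (at x)) + s *\<^sub>R matrix (frechet_derivative \<psi> (at x))"
proof -
  have "((\<lambda>x. r *\<^sub>R \<phi> x + s *\<^sub>R \<psi> x) has_derivative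
      (\<lambda>h. r *\<^sub>R frechet_derivative \<phi> (at x) h + s *\<^sub>R frechet_derivative \<psi> (at x) h)) (at x)"
    by (intro has_derivative_add has_derivative_scaleR_right
        test_function_has_derivative[OF assms(1)] test_function_has_derivative[OF assms(2)])
  from frechet_derivative_at[OF this, symmetric] show ?thesis
    by (simp add: vec_eq_iff matrix_nth)
qed

lemma l2_inner_cong_AE:
  assumes "f square_integrable_on \<Omega>" "g square_integrable_on \<Omega>" "h square_integrable_on \<Omega>"
    and "AE x in lebesgue_on \<Omega>. f x = g x"
  shows "l2_inner \<Omega> f h = l2_inner \<Omega> g h"
  unfolding l2_inner_def
proof (rule integral_cong_AE)
  show "AE x in lebesgue_on \<Omega>. f x \<bullet> h x = g x \<bullet> h x"
    using assms(4) by eventually_elim simp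
qed (use assms in \<open>auto simp: square_integrable_on_def\<close>)

lemma trace_eq_inner: "trace (A :: real^'n^'n) = A \<bullet> mat 1"
  by (simp add: trace_def inner_vec_def mat_def if_distrib[of "(*) _"] cong: if_cong)

text \<open>Identifies the pointwise linear combinations with a span in the function space.\<close>

lemma finite_dim_subspace_iff:
  "finite_dim_subspace S X \<longleftrightarrow> (\<exists>B. finite B \<and> B \<subseteq> X \<and> S = span B)"
proof -
  have sum: "(\<lambda>x. \<Sum>b\<in>B. c b *\<^sub>R b x) = (\<Sum>b\<in>B. c b *\<^sub>R b)"
    if "finite B" for B :: "('a \<Rightarrow> 'b) set" and c :: "('a \<Rightarrow> 'b) \<Rightarrow> real"
  proof
    show "(\<Sum>b\<in>B. c b *\<^sub>R b x) = (\<Sum>b\<in>B. c b *\<^sub>R b) x" for x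
      using that by induction (simp_all add: scaleR_fun_def)
  qed
  show ?thesis
    unfolding finite_dim_subspace_def by (metis (no_types, lifting) ext sum span_finite)
qed

lemma finite_dim_subspace_span:
  assumes "finite_dim_subspace S X" "X \<subseteq> Y" "subspace Y"
  shows "subspace S" "S \<subseteq> Y"
proof -
  obtain B where "B \<subseteq> X" "S = span B" using assms(1) by (auto simp: finite_dim_subspace_iff)
  then show "subspace S" "S \<subseteq> Y" using assms(2,3) by (simp_all add: span_minimal)
qed

lemma H10_gradient_zero: "H10_gradient \<Omega> (\<lambda>_. 0) (\<lambda>_. 0)"
  by (auto simp: H10_gradient_def square_integrable_on_def l2_norm_def l2_inner_def
      frechet_derivative_const vec_eq_iff matrix_def zero_vec_def[symmetric] test_function_zero intro!: exI[of _ "\<lambda>_ _. 0"])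

lemma l2_lin_tendsto_zero:
  fixes f g :: "nat \<Rightarrow> 'a::euclidean_space \<Rightarrow> 'b::euclidean_space"
  assumes sq: "\<And>n. f n square_integrable_on \<Omega>" "\<And>n. g n square_integrable_on \<Omega>"
    and lim: "(\<lambda>n. l2_norm \<Omega> (f n)) \<longlonglongrightarrow> 0" "(\<lambda>n. l2_norm \<Omega> (g n)) \<longlonglongrightarrow> 0"
  shows "(\<lambda>n. l2_norm \<Omega> (\<lambda>x. r *\<^sub>R f n x + s *\<^sub>R g n x)) \<longlonglongrightarrow> 0"
proof (rule Lim_null_comparison)
  have "l2_norm \<Omega> (r *\<^sub>R f n + s *\<^sub>R g n) \<le> \<bar>r\<bar> * l2_norm \<Omega> (f n) + \<bar>s\<bar> * l2_norm \<Omega> (g n)"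
    and "0 \<le> l2_norm \<Omega> (r *\<^sub>R f n + s *\<^sub>R g n)" for n
    using l2.N_add[of "r *\<^sub>R f n" \<Omega> "s *\<^sub>R g n"] l2.V_scale[of "f n" \<Omega> r] l2.V_scale[of "g n" \<Omega> s]
      l2.N_scale[of "f n" \<Omega> r] l2.N_scale[of "g n" \<Omega> s] sq
      l2.V_add[of "r *\<^sub>R f n" \<Omega> "s *\<^sub>R g n"] l2.N_nonneg[of "r *\<^sub>R f n + s *\<^sub>R g n" \<Omega>]
    by (auto simp: l2_N_eq[symmetric])
  then show "\<forall>\<^sub>F n in sequentially. norm (l2_norm \<Omega> (\<lambda>x. r *\<^sub>R f n x + s *\<^sub>R g n x))
      \<le> \<bar>r\<bar> * l2_norm \<Omega> (f n) + \<bar>s\<bar> * l2_norm \<Omega> (g n)"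
    by (simp add: fun_arith)
  have "(\<lambda>n. \<bar>r\<bar> * l2_norm \<Omega> (f n) + \<bar>s\<bar> * l2_norm \<Omega> (g n)) \<longlonglongrightarrow> \<bar>r\<bar> * 0 + \<bar>s\<bar> * 0"
    by (intro tendsto_intros lim)
  then show "(\<lambda>n. \<bar>r\<bar> * l2_norm \<Omega> (f n) + \<bar>s\<bar> * l2_norm \<Omega> (g n)) \<longlonglongrightarrow> 0" by simp
qed

context
  fixes \<Omega> :: "(real^'n::finite) set"
  assumes \<Omega>: "\<Omega> \<in> sets lebesgue" "bounded \<Omega>"
begin

lemma H10_gradient_lin:
  assumes vg: "H10_gradient \<Omega> v g" and wh: "H10_gradient \<Omega> w h"
  shows "H10_gradient \<Omega> (\<lambda>x. r *\<^sub>R v x + s *\<^sub>R w x) (\<lambda>x. r *\<^sub>R g x + s *\<^sub>R h x)"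
proof -
  obtain \<phi> where \<phi>: "\<And>n. test_function \<Omega> (\<phi> n)"
    "(\<lambda>n. l2_norm \<Omega> (\<lambda>x. \<phi> n x - v x)) \<longlonglongrightarrow> 0"
    "(\<lambda>n. l2_norm \<Omega> (\<lambda>x. matrix (frechet_derivative (\<phi> n) (at x)) - g x)) \<longlonglongrightarrow> 0"
    using vg by (auto simp: H10_gradient_def)
  obtain \<psi> where \<psi>: "\<And>n. test_function \<Omega> (\<psi> n)"
    "(\<lambda>n. l2_norm \<Omega> (\<lambda>x. \<psi> n x - w x)) \<longlonglongrightarrow> 0"
    "(\<lambda>n. l2_norm \<Omega> (\<lambda>x. matrix (frechet_derivative (\<psi> n) (at x)) - h x)) \<longlonglongrightarrow> 0"
    using wh by (auto simp: H10_gradient_def)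
  have sq: "v square_integrable_on \<Omega>" "g square_integrable_on \<Omega>"
    "w square_integrable_on \<Omega>" "h square_integrable_on \<Omega>"
    using vg wh by (auto simp: H10_gradient_def)
  have diff: "(\<lambda>x. a x - b x) square_integrable_on \<Omega>"
    if "continuous_on UNIV a" "b square_integrable_on \<Omega>" for a b :: "real^'n \<Rightarrow> 'c::euclidean_space"
    using square_integrable_lin[OF square_integrable_continuous[OF that(1) \<Omega>] that(2), of 1 "-1"] by simp
  have "(\<lambda>n. l2_norm \<Omega> (\<lambda>x. r *\<^sub>R (\<phi> n x - v x) + s *\<^sub>R (\<psi> n x - w x))) \<longlonglongrightarrow> 0"
    by (intro l2_lin_tendsto_zero diff sq \<phi>(2) \<psi>(2) test_function_continuous[OF \<phi>(1)]
        test_function_continuous[OF \<psi>(1)])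
  moreover have "(\<lambda>n. l2_norm \<Omega> (\<lambda>x. r *\<^sub>R (matrix (frechet_derivative (\<phi> n) (at x)) - g x)
      + s *\<^sub>R (matrix (frechet_derivative (\<psi> n) (at x)) - h x))) \<longlonglongrightarrow> 0"
    by (intro l2_lin_tendsto_zero diff sq \<phi>(3) \<psi>(3) test_function_continuous_matrix[OF \<phi>(1)]
        test_function_continuous_matrix[OF \<psi>(1)])
  ultimately show ?thesis
    unfolding H10_gradient_def using sq
    by (intro conjI square_integrable_lin exI[of _ "\<lambda>n x. r *\<^sub>R \<phi> n x + s *\<^sub>R \<psi> n x"])
      (auto simp: test_function_lin \<phi>(1) \<psi>(1) frechet_matrix_lin[OF \<phi>(1) \<psi>(1)] algebra_simps)
qed

lemma subspace_H10: "subspace (H10 \<Omega>)"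
proof (rule subspaceI)
  show "0 \<in> H10 \<Omega>" using H10_gradient_zero by (auto simp: H10_def zero_fun_def)
  show "v + w \<in> H10 \<Omega>" if "v \<in> H10 \<Omega>" "w \<in> H10 \<Omega>" for v w
    using that H10_gradient_lin[of v _ w _ 1 1] by (auto simp: H10_def plus_fun_def)
  show "r *\<^sub>R v \<in> H10 \<Omega>" if "v \<in> H10 \<Omega>" for r v
    using that H10_gradient_lin[of v _ v _ r 0] by (auto simp: H10_def scaleR_fun_def)
qed

lemma grad_H10: "v \<in> H10 \<Omega> \<Longrightarrow> H10_gradient \<Omega> v (grad \<Omega> v)"
  unfolding grad_def H10_def mem_Collect_eq by (rule someI_ex[of "H10_gradient \<Omega> v"])

lemma square_integrable_grad: "v \<in> H10 \<Omega> \<Longrightarrow> grad \<Omega> v square_integrable_on \<Omega>"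
  using grad_H10 by (simp add: H10_gradient_def)

lemma H10_lin: "v \<in> H10 \<Omega> \<Longrightarrow> w \<in> H10 \<Omega> \<Longrightarrow> r *\<^sub>R v + s *\<^sub>R w \<in> H10 \<Omega>"
  using subspace_H10 by (simp add: subspace_add subspace_scale)

text \<open>The choice behind \<open>grad\<close> is made for each field separately, so linearity
  can hold only almost everywhere; it compares two weak gradients of the same field.\<close>

lemma grad_lin:
  assumes "v \<in> H10 \<Omega>" "w \<in> H10 \<Omega>"
  shows "AE x in lebesgue_on \<Omega>. grad \<Omega> (r *\<^sub>R v + s *\<^sub>R w) x = r *\<^sub>R grad \<Omega> v x + s *\<^sub>R grad \<Omega> w x"
proof (rule H10_gradient_unique[OF grad_H10[OF H10_lin[OF assms]] _ _ \<Omega>])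
  show "H10_gradient \<Omega> (r *\<^sub>R v + s *\<^sub>R w) (\<lambda>x. r *\<^sub>R grad \<Omega> v x + s *\<^sub>R grad \<Omega> w x)"
    using H10_gradient_lin[OF grad_H10[OF assms(1)] grad_H10[OF assms(2)]] by (simp add: fun_arith)
qed simp

lemma l2_inner_grad_lin:
  assumes "u \<in> H10 \<Omega>" "v \<in> H10 \<Omega>" "h square_integrable_on \<Omega>"
  shows "l2_inner \<Omega> (grad \<Omega> (r *\<^sub>R u + s *\<^sub>R v)) h = r * l2_inner \<Omega> (grad \<Omega> u) h + s * l2_inner \<Omega> (grad \<Omega> v) h"
proof -
  have "l2_inner \<Omega> (grad \<Omega> (r *\<^sub>R u + s *\<^sub>R v)) h
      = l2_inner \<Omega> (\<lambda>x. r *\<^sub>R grad \<Omega> u x + s *\<^sub>R grad \<Omega> v x) h"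
    using assms by (intro l2_inner_cong_AE grad_lin square_integrable_lin square_integrable_grad H10_lin)
  also have "\<dots> = r * l2_inner \<Omega> (grad \<Omega> u) h + s * l2_inner \<Omega> (grad \<Omega> v) h"
    using l2.D_lin[of "grad \<Omega> u" \<Omega> "grad \<Omega> v" h r s] assms square_integrable_grad by (simp add: fun_arith)
  finally show ?thesis .
qed

text \<open>Moving q into the matrix field q I reduces linearity of the divergence to that of the
  gradient.\<close>

lemma l2_inner_divergence:
  "l2_inner \<Omega> (divergence \<Omega> v) q = l2_inner \<Omega> (grad \<Omega> v) (\<lambda>x. q x *\<^sub>R mat 1)"
  by (simp add: l2_inner_def divergence_def trace_eq_inner mult.commute)

lemma subspace_discretely_div_free:
  assumes Xh: "finite_dim_subspace Xh (H10 \<Omega>)" and Qh: "finite_dim_subspace Qh (L20 \<Omega>)"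
  shows "subspace (discretely_div_free \<Omega> Xh Qh)" "discretely_div_free \<Omega> Xh Qh \<subseteq> H10 \<Omega>"
proof -
  have X: "subspace Xh" "Xh \<subseteq> H10 \<Omega>"
    using finite_dim_subspace_span[OF Xh order_refl subspace_H10] by auto
  have "Qh \<subseteq> {q. q square_integrable_on \<Omega>}"
    using finite_dim_subspace_span(2)[OF Qh _ l2.V] by (auto simp: L20_def)
  then have q: "(\<lambda>x. q x *\<^sub>R (mat 1 :: real^'n^'n)) square_integrable_on \<Omega>" if "q \<in> Qh" for q
    using that by (auto simp: square_integrable_on_def power_mult_distrib)
  have lin: "l2_inner \<Omega> (divergence \<Omega> (r *\<^sub>R v + s *\<^sub>R w)) q
      = r * l2_inner \<Omega> (divergence \<Omega> v) q + s * l2_inner \<Omega> (divergence \<Omega> w) q"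
    if "v \<in> Xh" "w \<in> Xh" "q \<in> Qh" for r s v w q
    unfolding l2_inner_divergence using X that q by (intro l2_inner_grad_lin) auto
  show "subspace (discretely_div_free \<Omega> Xh Qh)"
  proof (rule subspaceI)
    \<comment> \<open>The chosen gradient of the zero field need not vanish everywhere; linearity
      with zero coefficients avoids computing it.\<close>
    show "0 \<in> discretely_div_free \<Omega> Xh Qh"
      using lin[of 0 0 _ 0 0] X by (auto simp: discretely_div_free_def subspace_0)
    show "v + w \<in> discretely_div_free \<Omega> Xh Qh"
      if "v \<in> discretely_div_free \<Omega> Xh Qh" "w \<in> discretely_div_free \<Omega> Xh Qh" for v w
      using that lin[of v w _ 1 1] X by (auto simp: discretely_div_free_def subspace_add)
    show "r *\<^sub>R v \<in> discretely_div_free \<Omega> Xh Qh" if "v \<in> discretely_div_free \<Omega> Xh Qh" for r v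
      using that lin[of v v _ r 0] X by (auto simp: discretely_div_free_def subspace_scale)
  qed
  show "discretely_div_free \<Omega> Xh Qh \<subseteq> H10 \<Omega>" using X by (auto simp: discretely_div_free_def)
qed

lemma trilinear_skew: "trilinear \<Omega> u w v = - trilinear \<Omega> u v w"
  by (simp add: trilinear_def field_simps)

text \<open>The integrals split because \<open>trilinear_bound\<close> includes their convergence.
  Convection is pointwise linear in the transporting field but only almost everywhere linear in the
  transported one; the third argument follows from the second by skew symmetry.\<close>

lemma trilinear_lin:
  assumes M: "trilinear_bound \<Omega> M" and H: "u \<in> H10 \<Omega>" "v \<in> H10 \<Omega>" "w \<in> H10 \<Omega>" "z \<in> H10 \<Omega>"
  shows "trilinear \<Omega> (r *\<^sub>R u + s *\<^sub>R v) w z = r * trilinear \<Omega> u w z + s * trilinear \<Omega> v w z" (is ?A)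
    and "trilinear \<Omega> w (r *\<^sub>R u + s *\<^sub>R v) z = r * trilinear \<Omega> w u z + s * trilinear \<Omega> w v z" (is ?B)
    and "trilinear \<Omega> w z (r *\<^sub>R u + s *\<^sub>R v) = r * trilinear \<Omega> w z u + s * trilinear \<Omega> w z v" (is ?C)
proof -
  have int: "integrable (lebesgue_on \<Omega>) (\<lambda>x. convection \<Omega> u v x \<bullet> w x)"
    if "u \<in> H10 \<Omega>" "v \<in> H10 \<Omega>" "w \<in> H10 \<Omega>" for u v w
    using M that by (simp add: trilinear_bound_def)
  have 1: "l2_inner \<Omega> (convection \<Omega> (r *\<^sub>R u + s *\<^sub>R v) w) z
      = r * l2_inner \<Omega> (convection \<Omega> u w) z + s * l2_inner \<Omega> (convection \<Omega> v w) z"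
    if "u \<in> H10 \<Omega>" "v \<in> H10 \<Omega>" "w \<in> H10 \<Omega>" "z \<in> H10 \<Omega>" for u v w z
    using int[OF that(1,3,4)] int[OF that(2,3,4)]
    by (simp add: l2_inner_def convection_def fun_arith matrix_vector_right_distrib
        matrix_vector_mult_scaleR inner_add_left)
  have 2: "l2_inner \<Omega> (convection \<Omega> w (r *\<^sub>R u + s *\<^sub>R v)) z
      = r * l2_inner \<Omega> (convection \<Omega> w u) z + s * l2_inner \<Omega> (convection \<Omega> w v) z"
    if "u \<in> H10 \<Omega>" "v \<in> H10 \<Omega>" "w \<in> H10 \<Omega>" "z \<in> H10 \<Omega>" for u v w z
  proof -
    have i: "integrable (lebesgue_on \<Omega>)
        (\<lambda>x. r * (convection \<Omega> w u x \<bullet> z x) + s * (convection \<Omega> w v x \<bullet> z x))"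
      using int[OF that(3,1,4)] int[OF that(3,2,4)] by simp
    have "l2_inner \<Omega> (convection \<Omega> w (r *\<^sub>R u + s *\<^sub>R v)) z
        = (LINT x|lebesgue_on \<Omega>. r * (convection \<Omega> w u x \<bullet> z x) + s * (convection \<Omega> w v x \<bullet> z x))"
      unfolding l2_inner_def
    proof (rule integral_cong_AE)
      show "AE x in lebesgue_on \<Omega>. convection \<Omega> w (r *\<^sub>R u + s *\<^sub>R v) x \<bullet> z x
          = r * (convection \<Omega> w u x \<bullet> z x) + s * (convection \<Omega> w v x \<bullet> z x)"
        using grad_lin[OF that(1,2), of r s]
        by eventually_elim (simp add: convection_def matrix_vector_mult_add_rdistrib
            scaleR_matrix_vector_assoc[symmetric] inner_add_left)
    qed (use int[OF that(3) H10_lin[OF that(1,2)] that(4)] i in blast)+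
    then show ?thesis using int[OF that(3,1,4)] int[OF that(3,2,4)] by (simp add: l2_inner_def)
  qed
  have 3: "l2_inner \<Omega> (convection \<Omega> w z) (r *\<^sub>R u + s *\<^sub>R v)
      = r * l2_inner \<Omega> (convection \<Omega> w z) u + s * l2_inner \<Omega> (convection \<Omega> w z) v"
    if "u \<in> H10 \<Omega>" "v \<in> H10 \<Omega>" "w \<in> H10 \<Omega>" "z \<in> H10 \<Omega>" for u v w z
    using int[OF that(3,4,1)] int[OF that(3,4,2)]
    by (simp add: l2_inner_def fun_arith inner_add_right)
  show ?A using H by (simp add: trilinear_def 1 field_simps)
  show ?B using H by (simp add: trilinear_def 2 3 field_simps)
  then show ?C by (simp add: trilinear_skew[of w _ z])
qed

text \<open>The supremum in \<open>dual_norm\<close> ranges over fields with nonzero L2 norm. A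
  field with nonzero gradient norm is among them by uniqueness of gradients; if the gradient norm is
  0, boundedness of f gives f v = 0.\<close>

lemma forcing_le:
  assumes f: "forcing \<Omega> f" and v: "v \<in> H10 \<Omega>"
  shows "f v \<le> dual_norm \<Omega> f * grad_norm \<Omega> v"
proof -
  have "\<exists>K. \<forall>v\<in>H10 \<Omega>. \<bar>f v\<bar> \<le> K * grad_norm \<Omega> v"
    using f unfolding forcing_def by (rule conjunct2)
  then obtain K where "\<forall>v\<in>H10 \<Omega>. \<bar>f v\<bar> \<le> K * grad_norm \<Omega> v"
    by (rule exE)
  then have K: "\<bar>f w\<bar> \<le> K * grad_norm \<Omega> w" if "w \<in> H10 \<Omega>" for w
    using that by (rule bspec)
  have nn: "0 \<le> grad_norm \<Omega> w" if "w \<in> H10 \<Omega>" for w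
    using l2.N_nonneg[of "grad \<Omega> w" \<Omega>] square_integrable_grad[OF that]
    by (simp add: grad_norm_def l2_N_eq)
  show ?thesis
  proof (cases "grad_norm \<Omega> v = 0")
    case True
    then show ?thesis using K[OF v] by simp
  next
    case False
    then have pos: "0 < grad_norm \<Omega> v" using nn[OF v] by simp
    have "l2_norm \<Omega> v \<noteq> 0"
    proof
      assume "l2_norm \<Omega> v = 0"
      then have "(LINT x|lebesgue_on \<Omega>. (norm (v x))\<^sup>2) = 0"
        by (simp add: l2_norm_def l2_inner_def power2_norm_eq_inner)
      moreover have "integrable (lebesgue_on \<Omega>) (\<lambda>x. (norm (v x))\<^sup>2)"
        using grad_H10[OF v] by (simp add: H10_gradient_def square_integrable_on_def)
      ultimately have "AE x in lebesgue_on \<Omega>. v x = 0"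
        by (simp add: integral_nonneg_eq_0_iff_AE)
      then have "AE x in lebesgue_on \<Omega>. grad \<Omega> v x = 0"
        by (rule H10_gradient_unique[OF grad_H10[OF v] H10_gradient_zero _ \<Omega>])
      then have "grad_norm \<Omega> v = l2_norm \<Omega> (\<lambda>_. 0 :: real^'n^'n)"
        unfolding grad_norm_def l2_norm_def l2_inner_def using square_integrable_grad[OF v]
        by (intro arg_cong[where f = sqrt] integral_cong_AE) (auto simp: square_integrable_on_def)
      then show False using False by (simp add: l2_norm_def l2_inner_def)
    qed
    moreover have "bdd_above ((\<lambda>v. f v / grad_norm \<Omega> v) ` {v \<in> H10 \<Omega>. l2_norm \<Omega> v \<noteq> 0})"
    proof (rule bdd_aboveI2)
      fix w assume "w \<in> {v \<in> H10 \<Omega>. l2_norm \<Omega> v \<noteq> 0}"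
      \<comment> \<open>The 0 covers a zero denominator, where the quotient is 0 by
        convention.\<close>
      then show "f w / grad_norm \<Omega> w \<le> max K 0"
        using K[of w] nn[of w] by (cases "grad_norm \<Omega> w = 0") (auto simp: field_simps le_max_iff_disj)
    qed
    ultimately have "f v / grad_norm \<Omega> v \<le> dual_norm \<Omega> f"
      unfolding dual_norm_def using v by (intro cSUP_upper) auto
    then show ?thesis using pos by (simp add: field_simps)
  qed
qed

end

section \<open>Transfer to the discretely divergence-free space\<close>

theorem theorem3p12:
  fixes M :: "real \<Rightarrow> real"
  assumes dim: "CARD('n::finite) = 2 \<or> CARD('n) = 3"
    and M: "\<And>\<Omega>::(real^'n) set. flow_domain \<Omega> \<Longrightarrow> trilinear_bound \<Omega> (M (measure lebesgue \<Omega>))"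
  shows "\<exists>C :: real \<Rightarrow> real \<Rightarrow> real \<Rightarrow> ('n vfield \<Rightarrow> real) \<Rightarrow> real \<Rightarrow> real \<Rightarrow> real \<Rightarrow> real.
    \<forall>(\<Omega>::(real^'n) set) \<nu> R f Xh Qh Vh u ut y \<alpha>\<^sub>2 \<beta>\<^sub>1 \<beta>\<^sub>2 (k::nat).
      flow_domain \<Omega> \<longrightarrow>
      \<nu> > 0 \<longrightarrow>
      forcing \<Omega> f \<longrightarrow>
      M (measure lebesgue \<Omega>) * dual_norm \<Omega> f / \<nu>\<^sup>2 < 1 \<longrightarrow>
      R < \<nu> / M (measure lebesgue \<Omega>) \<longrightarrow>
      stable_pair \<Omega> Xh Qh \<longrightarrow>
      Vh = discretely_div_free \<Omega> Xh Qh \<longrightarrow>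
      k \<ge> 3 \<longrightarrow>
      anderson_newton2 \<Omega> \<nu> f Vh R (k + 1) u ut y \<alpha>\<^sub>2 \<beta>\<^sub>1 \<beta>\<^sub>2 \<longrightarrow>
      \<beta>\<^sub>2 k \<noteq> 0 \<longrightarrow>
      (\<forall>j\<le>k. u j \<in> grad_ball \<Omega> Vh R) \<longrightarrow>
      grad_norm \<Omega> (y (k + 1)) \<le>
        C \<nu> (measure lebesgue \<Omega>) R f (\<beta>\<^sub>1 k) (\<beta>\<^sub>2 k) (anderson_gain \<Omega> y \<beta>\<^sub>1 \<beta>\<^sub>2 k) *
          (grad_norm \<Omega> (y k) + grad_norm \<Omega> (y (k - 1))) powr (3 / 2)"
proof (intro exI[of _ "\<lambda>\<nu> \<mu> R f \<beta>\<^sub>1 \<beta>\<^sub>2 \<theta>. anderson_const (M \<mu>) \<nu> R \<beta>\<^sub>1 \<beta>\<^sub>2"] allI impI)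
  fix \<Omega> :: "(real^'n) set" and \<nu> R f Xh Qh Vh u ut y \<alpha>\<^sub>2 \<beta>\<^sub>1 \<beta>\<^sub>2 and k :: nat
  assume dom: "flow_domain \<Omega>" and \<nu>: "\<nu> > 0" and f: "forcing \<Omega> f"
    and small: "M (measure lebesgue \<Omega>) * dual_norm \<Omega> f / \<nu>\<^sup>2 < 1"
    and R: "R < \<nu> / M (measure lebesgue \<Omega>)" and stable: "stable_pair \<Omega> Xh Qh"
    and Vh: "Vh = discretely_div_free \<Omega> Xh Qh" and k: "k \<ge> 3"
    and run: "anderson_newton2 \<Omega> \<nu> f Vh R (k + 1) u ut y \<alpha>\<^sub>2 \<beta>\<^sub>1 \<beta>\<^sub>2" and \<beta>: "\<beta>\<^sub>2 k \<noteq> 0"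
    and ball: "\<forall>j\<le>k. u j \<in> grad_ball \<Omega> Vh R"
  \<comment> \<open>The constant sees the domain through \<open>M\<close> at its measure, and the
    forcing through the bound \<open>\<nu>\<^sup>2 / m\<close> on its dual norm.\<close>
  define m where "m = M (measure lebesgue \<Omega>)"
  have \<Omega>: "\<Omega> \<in> sets lebesgue" "bounded \<Omega>"
    using dom by (auto simp: flow_domain_def)
  have bound: "trilinear_bound \<Omega> m" using M[OF dom] by (simp add: m_def)
  have m: "m > 0" using bound by (simp add: trilinear_bound_def)
  have sub: "subspace Vh" "Vh \<subseteq> H10 \<Omega>"
    using subspace_discretely_div_free[OF \<Omega>] stable by (auto simp: Vh stable_pair_def)
  have H: "v \<in> H10 \<Omega>" if "v \<in> Vh" for v using sub that by blast
  have N_eq: "sqrt (l2_inner \<Omega> (grad \<Omega> v) (grad \<Omega> v)) = grad_norm \<Omega> v" for v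
    by (simp add: grad_norm_def l2_norm_def)
  \<comment> \<open>Integration removes the exceptional null sets, so the forms are exactly linear
    although \<open>grad\<close> is not.\<close>
  interpret nse: navier_stokes_form Vh "\<lambda>v w. l2_inner \<Omega> (grad \<Omega> v) (grad \<Omega> w)"
    "trilinear \<Omega>" m \<nu> R f
  proof
    show "l2_inner \<Omega> (grad \<Omega> (r *\<^sub>R u + s *\<^sub>R v)) (grad \<Omega> w)
        = r * l2_inner \<Omega> (grad \<Omega> u) (grad \<Omega> w) + s * l2_inner \<Omega> (grad \<Omega> v) (grad \<Omega> w)"
      if "u \<in> Vh" "v \<in> Vh" "w \<in> Vh" for r s u v w
      using that H by (intro l2_inner_grad_lin square_integrable_grad \<Omega>) auto
    show "l2_inner \<Omega> (grad \<Omega> u) (grad \<Omega> v) = l2_inner \<Omega> (grad \<Omega> v) (grad \<Omega> u)" for u v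
      by (rule l2.D_sym)
    show "0 \<le> l2_inner \<Omega> (grad \<Omega> u) (grad \<Omega> u)" for u
      by (simp add: l2_inner_def)
    show "trilinear \<Omega> u v v = 0" for u v
      by (simp add: trilinear_def)
    show "trilinear \<Omega> u v w \<le> m * sqrt (l2_inner \<Omega> (grad \<Omega> u) (grad \<Omega> u))
        * sqrt (l2_inner \<Omega> (grad \<Omega> v) (grad \<Omega> v)) * sqrt (l2_inner \<Omega> (grad \<Omega> w) (grad \<Omega> w))"
      if "u \<in> Vh" "v \<in> Vh" "w \<in> Vh" for u v w
      using bound H that by (simp add: trilinear_bound_def N_eq)
    have "dual_norm \<Omega> f \<le> \<nu>\<^sup>2 / m"
      using small m \<nu> by (simp add: m_def field_simps)
    then show "f v \<le> \<nu>\<^sup>2 / m * sqrt (l2_inner \<Omega> (grad \<Omega> v) (grad \<Omega> v))" if "v \<in> Vh" for v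
    proof -
      have "0 \<le> grad_norm \<Omega> v" by (simp add: l2_inner_def flip: N_eq)
      with \<open>dual_norm \<Omega> f \<le> \<nu>\<^sup>2 / m\<close> show ?thesis
        unfolding N_eq by (intro order_trans[OF forcing_le[OF \<Omega> f H[OF that]] mult_right_mono])
    qed
    fix r s u v w z assume "u \<in> Vh" "v \<in> Vh" "w \<in> Vh" "z \<in> Vh"
    note lin = trilinear_lin[OF \<Omega> bound this[THEN H]]
    show "trilinear \<Omega> (r *\<^sub>R u + s *\<^sub>R v) w z = r * trilinear \<Omega> u w z + s * trilinear \<Omega> v w z"
      by (rule lin)
    show "trilinear \<Omega> w (r *\<^sub>R u + s *\<^sub>R v) z = r * trilinear \<Omega> w u z + s * trilinear \<Omega> w v z"
      by (rule lin)
    show "trilinear \<Omega> w z (r *\<^sub>R u + s *\<^sub>R v) = r * trilinear \<Omega> w z u + s * trilinear \<Omega> w z v"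
      by (rule lin)
  qed (use sub R \<nu> m in \<open>simp_all add: m_def\<close>)
  have N: "nse.N v = grad_norm \<Omega> v" for v by (simp add: nse.N_def N_eq)
  \<comment> \<open>Step j starts from iterate j-1, so the ball condition up to index k covers the
    steps up to k+1.\<close>
  have newton: "nse.newton (u (j - 1)) (ut j)" "u (j - 1) \<in> Vh" "nse.N (u (j - 1)) \<le> R"
    and y: "y j = ut j - u (j - 1)" if "1 \<le> j" "j \<le> k + 1" for j
  proof -
    have j: "newton_solution \<Omega> \<nu> f Vh (u (j - 1)) (ut j)" "y j = (\<lambda>x. ut j x - u (j - 1) x)"
      using run[unfolded anderson_newton2_def, THEN conjunct2, THEN conjunct1] that by simp_all
    show "nse.newton (u (j - 1)) (ut j)"
      using j(1) unfolding newton_solution_def nse.newton_def .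
    have "u (j - 1) \<in> grad_ball \<Omega> Vh R"
      using ball that by simp
    then show "u (j - 1) \<in> Vh" "nse.N (u (j - 1)) \<le> R"
      by (simp_all add: grad_ball_def N)
    show "y j = ut j - u (j - 1)"
      using j(2) by (simp add: fun_diff_def)
  qed
  have c3: "combine3 a b v w z = (1 - a - b) *\<^sub>R v + a *\<^sub>R w + b *\<^sub>R z" for a b and v w z :: "'n vfield"
    by (simp add: combine3_def fun_arith)
  have step: "is_arg_min (\<lambda>(a, b). grad_norm \<Omega> (combine3 a b (y k) (y (k - 1)) (y (k - 2)))) (\<lambda>_. True) (\<beta>\<^sub>1 k, \<beta>\<^sub>2 k)"
    and u_k: "u k = combine3 (\<beta>\<^sub>1 k) (\<beta>\<^sub>2 k) (ut k) (ut (k - 1)) (ut (k - 2))"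
    using run[unfolded anderson_newton2_def, THEN conjunct2, THEN conjunct2, THEN conjunct2, THEN conjunct2] k
    by simp_all
  have opt: "nse.N (combine3 (\<beta>\<^sub>1 k) (\<beta>\<^sub>2 k) (y k) (y (k - 1)) (y (k - 2))) \<le> nse.N (y k)"
  proof -
    \<comment> \<open>Zero coefficients are an admissible competitor in the minimisation.\<close>
    have "combine3 0 0 (y k) (y (k - 1)) (y (k - 2)) = y k" by (simp add: combine3_def)
    then show ?thesis
      using step unfolding is_arg_min_def N by (metis (mono_tags, lifting) case_prod_conv not_less)
  qed
  have ys: "y k = ut k - u (k - 1)" "y (k - 1) = ut (k - 1) - u (k - 1 - 1)"
    "y (k - 2) = ut (k - 2) - u (k - 2 - 1)" "y (k + 1) = ut (k + 1) - u (k + 1 - 1)"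
    using k y[of k] y[of "k - 1"] y[of "k - 2"] y[of "k + 1"] by simp_all
  have "nse.N (ut (k + 1) - u (k + 1 - 1)) \<le> anderson_const m \<nu> R (\<beta>\<^sub>1 k) (\<beta>\<^sub>2 k)
      * (nse.N (ut k - u (k - 1)) + nse.N (ut (k - 1) - u (k - 1 - 1))) powr (3 / 2)"
  \<comment> \<open>The oldest pair does not occur in the conclusion and is given explicitly; k
    \<ge> 3 makes \<open>k - 2 - 1\<close> the true index k-3.\<close>
  proof (intro nse.anderson_step[where ?u2.0 = "u (k - 2 - 1)" and ?g2.0 = "ut (k - 2)"])
    show "u (k + 1 - 1) = (1 - \<beta>\<^sub>1 k - \<beta>\<^sub>2 k) *\<^sub>R ut k + \<beta>\<^sub>1 k *\<^sub>R ut (k - 1) + \<beta>\<^sub>2 k *\<^sub>R ut (k - 2)"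
      by (simp only: u_k c3 diff_add_inverse2)
    show "nse.N ((1 - \<beta>\<^sub>1 k - \<beta>\<^sub>2 k) *\<^sub>R (ut k - u (k - 1)) + \<beta>\<^sub>1 k *\<^sub>R (ut (k - 1) - u (k - 1 - 1))
        + \<beta>\<^sub>2 k *\<^sub>R (ut (k - 2) - u (k - 2 - 1))) \<le> nse.N (ut k - u (k - 1))"
      using opt by (simp only: c3 ys)
  qed (use k \<beta> newton[of k] newton[of "k - 1"] newton[of "k - 2"] newton[of "k + 1"] in simp_all)
  then show "grad_norm \<Omega> (y (k + 1)) \<le> anderson_const (M (measure lebesgue \<Omega>)) \<nu> R (\<beta>\<^sub>1 k) (\<beta>\<^sub>2 k)
      * (grad_norm \<Omega> (y k) + grad_norm \<Omega> (y (k - 1))) powr (3 / 2)"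
    by (simp only: ys N m_def)
qed

end
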